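(* Let $F$ be a field, let $P$ be the prime field of $F$, and let $G$ and $H$ be finite groups. If $FG\cong FH$ as $F$-algebras, then there exists a finite field extension $F_0$ of $P$ such that $F_0G\cong F_0H$ as $F_0$-algebras.
   Context: For a field $K$ and a group $G$, $KG$ denotes the group algebra of $G$ over $K$. Isomorphisms between group algebras over $K$ are isomorphisms of $K$-algebras. The prime field of $F$ is its smallest subfield (isomorphic to $\mathbb{Q}$ or to the field with $p$ elements for a prime $p$). The field $F_0$ is a finite-degree field extension of $P$ and is not required to be contained in $F$. *)

theory Defs
  imports "HOL-Algebra.Algebra"
begin

text \<open>Elements of the group algebra are the finitely supported functions on \<^term>\<open>carrier G\<close>,
  made extensional so that equality of functions is equality in the algebra.
  Scalars act through the \<^const>\<open>smult\<close> field of the module record.\<close>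

definition group_algebra ::
    "('k, 'm) ring_scheme \<Rightarrow> ('g, 'n) monoid_scheme \<Rightarrow> ('k, 'g \<Rightarrow> 'k) module" where
  "group_algebra K G =
    \<lparr> carrier = {f \<in> carrier G \<rightarrow>\<^sub>E carrier K. finite {x \<in> carrier G. f x \<noteq> \<zero>\<^bsub>K\<^esub>}},
      monoid.mult = (\<lambda>f g. \<lambda>x\<in>carrier G.
        \<Oplus>\<^bsub>K\<^esub>y\<in>{y \<in> carrier G. f y \<noteq> \<zero>\<^bsub>K\<^esub>}. f y \<otimes>\<^bsub>K\<^esub> g (inv\<^bsub>G\<^esub> y \<otimes>\<^bsub>G\<^esub> x)),
      one = (\<lambda>x\<in>carrier G. if x = \<one>\<^bsub>G\<^esub> then \<one>\<^bsub>K\<^esub> else \<zero>\<^bsub>K\<^esub>),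
      ring.zero = (\<lambda>x\<in>carrier G. \<zero>\<^bsub>K\<^esub>),
      add = (\<lambda>f g. \<lambda>x\<in>carrier G. f x \<oplus>\<^bsub>K\<^esub> g x),
      smult = (\<lambda>a f. \<lambda>x\<in>carrier G. a \<otimes>\<^bsub>K\<^esub> f x) \<rparr>"

text \<open>The library's locale \<^locale>\<open>algebra\<close> covers commutative algebras only, so isomorphisms
  of possibly noncommutative algebras are described directly.\<close>

definition algebra_iso ::
    "('k, 'm) ring_scheme \<Rightarrow> ('k, 'a, 'p) module_scheme \<Rightarrow> ('k, 'b, 'q) module_scheme
      \<Rightarrow> ('a \<Rightarrow> 'b) set" where
  "algebra_iso K A B =
    {h \<in> ring_iso A B. \<forall>a\<in>carrier K. \<forall>x\<in>carrier A. h (a \<odot>\<^bsub>A\<^esub> x) = a \<odot>\<^bsub>B\<^esub> h x}"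

definition algebra_isomorphic ::
    "('k, 'm) ring_scheme \<Rightarrow> ('k, 'a, 'p) module_scheme \<Rightarrow> ('k, 'b, 'q) module_scheme
      \<Rightarrow> bool" where
  "algebra_isomorphic K A B \<longleftrightarrow> algebra_iso K A B \<noteq> {}"

definition prime_field :: "('a, 'm) ring_scheme \<Rightarrow> 'a set" where
  "prime_field F = \<Inter>{K. subfield K F}"

lemma (in field) prime_field_is_subfield: "subfield (prime_field R) R"
  using generate_field_is_subfield[of "{}"] generate_field_min_subfield2[of "{}"]
  by (simp add: prime_field_def)

text \<open>A field extension of \<^term>\<open>K\<close> is a field \<^term>\<open>L\<close> with an embedding \<^term>\<open>\<phi>\<close> of
  \<^term>\<open>K\<close> (homomorphisms of fields are injective); its degree is the dimension of \<^term>\<open>L\<close> over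
  the image of \<^term>\<open>\<phi>\<close>. A finite extension of a prime field is countable, so every such
  extension has an isomorphic copy whose carrier consists of natural numbers.\<close>

definition finite_field_extension ::
    "('a, 'm) ring_scheme \<Rightarrow> ('b, 'n) ring_scheme \<Rightarrow> ('a \<Rightarrow> 'b) \<Rightarrow> bool" where
  "finite_field_extension K L \<phi> \<longleftrightarrow>
    field K \<and> field L \<and> \<phi> \<in> ring_hom K L \<and>
    ring.finite_dimension L (\<phi> ` carrier K) (carrier L)"

end

theory Submission
  imports Defs "HOL-Library.Countable_Set"
begin

text \<open>An isomorphism \<open>FG \<rightarrow> FH\<close> and its inverse are given by two finite matrices over \<open>F\<close>, and being such
  a pair of matrices is a system of polynomial equations with coefficients in the prime field \<open>P\<close>.
  The entries generate a finitely generated \<open>P\<close>-algebra \<open>K \<subseteq> F\<close>. Adjoining one generator at a time, the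
  embedding of \<open>P\<close> into its algebraic closure extends to a ring homomorphism on \<open>K\<close>; the induction
  carries along that a given nonzero element stays nonzero, so that the leading coefficients which
  govern the next step can be kept away from zero. The images of the entries lie in a finite
  extension of \<open>P\<close> and still solve the equations. This extension is countable, hence has a copy
  on a set of natural numbers.\<close>

section \<open>Extending homomorphisms to finitely generated subrings\<close>

text \<open>The homomorphism on \<open>K\<close> is a specialisation: transcendental entries are
  sent to algebraic elements, so it is in general not injective. A nonzero determinant could
  therefore become zero, and bijectivity of a linear map would be lost. Recording the inverse matrix
  as well turns bijectivity into equations, and these survive every ring homomorphism, injective or
  not. The intermediate rings are domains and not fields. Division with remainder works there only
  up to powers of a leading coefficient, and a polynomial may drop in degree under specialisation
  and lose its roots. Both defects are controlled by a single nonzero element of the smaller ring,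
  fixed before the homomorphism is known. This order of choice is what makes the induction run
  downwards from the last generator.\<close>

text \<open>The homomorphism theorem without a quotient ring: two preimages of the same element
  differ by an element killed by \<open>e\<close>, hence by \<open>g\<close>, so the value may be
  computed from any chosen preimage. The subset \<open>T\<close> is free because the simple
  extension, as a subset of the ambient field, will be put in its place.\<close>

lemma ring_hom_factor:
  assumes e: "ring_hom_ring A B e" and g: "ring_hom_ring A C g"
    and ker: "\<And>p. p \<in> carrier A \<Longrightarrow> e p = \<zero>\<^bsub>B\<^esub> \<Longrightarrow> g p = \<zero>\<^bsub>C\<^esub>"
    and T: "T \<subseteq> e ` carrier A"
  obtains \<psi> where "\<psi> \<in> ring_hom (B\<lparr>carrier := T\<rparr>) C" "\<And>p. p \<in> carrier A \<Longrightarrow> \<psi> (e p) = g p"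
proof -
  interpret e: ring_hom_ring A B e by (rule e)
  interpret g: ring_hom_ring A C g by (rule g)
  define \<psi> where "\<psi> z = g (SOME p. p \<in> carrier A \<and> e p = z)" for z
  have eq: "\<psi> (e p) = g p" if p: "p \<in> carrier A" for p
  proof -
    define q where "q = (SOME q. q \<in> carrier A \<and> e q = e p)"
    have q: "q \<in> carrier A" "e q = e p"
      using someI[of "\<lambda>q. q \<in> carrier A \<and> e q = e p" p] p by (auto simp: q_def)
    have "e (q \<ominus>\<^bsub>A\<^esub> p) = \<zero>\<^bsub>B\<^esub>"
      using p q by (simp add: a_minus_def e.S.r_neg)
    then have "g q \<ominus>\<^bsub>C\<^esub> g p = \<zero>\<^bsub>C\<^esub>"
      using ker[of "q \<ominus>\<^bsub>A\<^esub> p"] p q by (simp add: a_minus_def)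
    then have "g q = g p"
      using p q by simp
    then show ?thesis by (simp add: \<psi>_def q_def)
  qed
  have "\<psi> \<in> ring_hom (B\<lparr>carrier := T\<rparr>) C"
  proof (rule ring_hom_memI)
    fix x assume "x \<in> carrier (B\<lparr>carrier := T\<rparr>)"
    then obtain p where "p \<in> carrier A" "x = e p" using T by auto
    then show "\<psi> x \<in> carrier C" by (simp add: eq)
  next
    fix x y assume "x \<in> carrier (B\<lparr>carrier := T\<rparr>)" "y \<in> carrier (B\<lparr>carrier := T\<rparr>)"
    then have "x \<in> e ` carrier A" "y \<in> e ` carrier A" using T by auto
    then obtain p q where pq: "p \<in> carrier A" "x = e p" "q \<in> carrier A" "y = e q"
      by blast
    show "\<psi> (x \<otimes>\<^bsub>B\<lparr>carrier := T\<rparr>\<^esub> y) = \<psi> x \<otimes>\<^bsub>C\<^esub> \<psi> y"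
      using pq eq[of "p \<otimes>\<^bsub>A\<^esub> q"] by (simp add: eq)
    show "\<psi> (x \<oplus>\<^bsub>B\<lparr>carrier := T\<rparr>\<^esub> y) = \<psi> x \<oplus>\<^bsub>C\<^esub> \<psi> y"
      using pq eq[of "p \<oplus>\<^bsub>A\<^esub> q"] by (simp add: eq)
  next
    show "\<psi> \<one>\<^bsub>B\<lparr>carrier := T\<rparr>\<^esub> = \<one>\<^bsub>C\<^esub>"
      using eq[of "\<one>\<^bsub>A\<^esub>"] by simp
  qed
  then show ?thesis using that eq by blast
qed

section \<open>Polynomial relations of one element over a domain\<close>

text \<open>In degree zero, \<open>p\<close> would be a nonzero constant killed by \<open>e\<close>,
  although \<open>e\<close> is injective on constants. Positive degree is what later gives the
  specialised relation a root.\<close>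

lemma (in UP_domain) deg_pos_of_relation:
  assumes "e \<in> ring_hom P S" and "\<And>c. c \<in> carrier R \<Longrightarrow> e (up_ring.monom P c 0) = \<zero>\<^bsub>S\<^esub> \<Longrightarrow> c = \<zero>"
    and "p \<in> carrier P" "p \<noteq> \<zero>\<^bsub>P\<^esub>" "e p = \<zero>\<^bsub>S\<^esub>"
  shows "0 < deg R p"
proof (rule ccontr)
  assume "\<not> 0 < deg R p"
  then have p: "p = up_ring.monom P (up_ring.coeff P p 0) 0"
    using assms(3) deg_zero_impl_monom by simp
  then have "up_ring.coeff P p 0 = \<zero>" using assms by (metis coeff_closed)
  then show False using p assms(4) by simp
qed

text \<open>Bezout's identity over the fraction field of \<^term>\<open>R\<close>, where the minimal relation \<open>p\<close> is
  irreducible, with denominators cleared.\<close>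

lemma (in UP_domain) minimal_relation_bezout:
  assumes S: "domain S" and e: "e \<in> ring_hom P S"
    and inj: "\<And>c. c \<in> carrier R \<Longrightarrow> e (up_ring.monom P c 0) = \<zero>\<^bsub>S\<^esub> \<Longrightarrow> c = \<zero>"
    and p: "p \<in> carrier P" "p \<noteq> \<zero>\<^bsub>P\<^esub>" "e p = \<zero>\<^bsub>S\<^esub>"
    and min: "\<And>r. r \<in> carrier P \<Longrightarrow> e r = \<zero>\<^bsub>S\<^esub> \<Longrightarrow> deg R r < deg R p \<Longrightarrow> r = \<zero>\<^bsub>P\<^esub>"
    and q: "q \<in> carrier P" "e q \<noteq> \<zero>\<^bsub>S\<^esub>"
  shows "\<exists>c\<in>carrier R. \<exists>v\<in>carrier P. c \<noteq> \<zero> \<and> e (up_ring.monom P c 0) = e q \<otimes>\<^bsub>S\<^esub> e v"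
proof -
  interpret S: domain S by (rule S)
  interpret e: ring_hom_ring P S e
    using e by (rule ring_hom_ringI2[OF UP_ring S.ring_axioms])
  \<comment> \<open>Modulo the kernel of \<open>e\<close>, the members of \<open>W\<close> are the
    multiples of \<open>q\<close> that \<open>e\<close> does not kill. A member of least degree
    takes the role of the gcd of \<open>p\<close> and \<open>q\<close>; it remains to see that it is
    constant.\<close>
  define W where "W w \<longleftrightarrow> w \<in> carrier P \<and> e w \<noteq> \<zero>\<^bsub>S\<^esub> \<and> (\<exists>v\<in>carrier P. e w = e q \<otimes>\<^bsub>S\<^esub> e v)" for w
  have "W q"
    unfolding W_def using q by (auto intro!: bexI[of _ "\<one>\<^bsub>P\<^esub>"])
  then obtain w where w: "W w" and wmin: "\<And>u. W u \<Longrightarrow> deg R w \<le> deg R u"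
    using ex_has_least_nat[of W q "deg R"] by blast
  obtain v where v: "v \<in> carrier P" "e w = e q \<otimes>\<^bsub>S\<^esub> e v"
    using w by (auto simp: W_def)
  have wP: "w \<in> carrier P" "e w \<noteq> \<zero>\<^bsub>S\<^esub>" using w by (auto simp: W_def)
  then have w0: "w \<noteq> \<zero>\<^bsub>P\<^esub>" by auto
  have smult: "e (a \<odot>\<^bsub>P\<^esub> u) = e (up_ring.monom P a 0) \<otimes>\<^bsub>S\<^esub> e u" if "a \<in> carrier R" "u \<in> carrier P" for a u
    using that by (simp flip: monom_mult_is_smult)
  have pow: "(lcoeff u) [^] k \<noteq> \<zero>" "(lcoeff u) [^] k \<in> carrier R" "e (up_ring.monom P (lcoeff u [^] k) 0) \<noteq> \<zero>\<^bsub>S\<^esub>"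
    if "u \<in> carrier P" "u \<noteq> \<zero>\<^bsub>P\<^esub>" for u and k :: nat
  proof -
    show c: "(lcoeff u) [^] k \<in> carrier R" using that by simp
    show n: "(lcoeff u) [^] k \<noteq> \<zero>"
      using that lcoeff_nonzero2 by (induct k) (auto simp: R.integral_iff)
    show "e (up_ring.monom P (lcoeff u [^] k) 0) \<noteq> \<zero>\<^bsub>S\<^esub>" using inj c n by blast
  qed
  \<comment> \<open>Pseudo-division of \<open>w\<close> by \<open>p\<close>: since
    \<open>e p\<close> vanishes, \<open>e r\<close> is \<open>e w\<close> times the value of a power
    of the leading coefficient of \<open>p\<close>. Hence \<open>r\<close> lies in \<open>W\<close>,
    with a degree below that of \<open>p\<close>.\<close>
  have degwp: "deg R w < deg R p"
  proof (rule ccontr)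
    assume ge: "\<not> deg R w < deg R p"
    obtain s r and k :: nat where sr: "s \<in> carrier P" "r \<in> carrier P"
      "lcoeff p [^] k \<odot>\<^bsub>P\<^esub> w = p \<otimes>\<^bsub>P\<^esub> s \<oplus>\<^bsub>P\<^esub> r" "r = \<zero>\<^bsub>P\<^esub> \<or> deg R r < deg R p"
      using long_div_theorem[OF p(1) wP(1) p(2)] by blast
    have er: "e r = e (up_ring.monom P (lcoeff p [^] k) 0) \<otimes>\<^bsub>S\<^esub> e w"
      using arg_cong[OF sr(3), of e] p sr(1,2) pow[OF p(1,2)] wP smult by simp
    then have "e r \<noteq> \<zero>\<^bsub>S\<^esub>"
      using pow[OF p(1,2)] wP by (simp add: S.integral_iff)
    moreover have "e r = e q \<otimes>\<^bsub>S\<^esub> e (up_ring.monom P (lcoeff p [^] k) 0 \<otimes>\<^bsub>P\<^esub> v)"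
      using er v q pow(2)[OF p(1,2)] by (simp add: S.m_ac)
    ultimately have "W r"
      unfolding W_def using sr(2) v(1) pow(2)[OF p(1,2)]
      by (intro conjI bexI[of _ "up_ring.monom P (lcoeff p [^] k) 0 \<otimes>\<^bsub>P\<^esub> v"]) simp_all
    with wmin[of r] ge sr(4) \<open>e r \<noteq> \<zero>\<^bsub>S\<^esub>\<close> show False by auto
  qed
  \<comment> \<open>Pseudo-division of \<open>p\<close> by \<open>w\<close>: the remainder is a
    multiple of \<open>q\<close> modulo the kernel, so minimality of \<open>w\<close> puts it into
    the kernel and minimality of \<open>p\<close> makes it zero. Then \<open>w\<close> divides a
    constant multiple of \<open>p\<close>, and for nonconstant \<open>w\<close> the cofactor
    \<open>s\<close> would be a relation of smaller degree than \<open>p\<close>.\<close>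
  have "deg R w = 0"
  proof (rule ccontr)
    assume pos: "deg R w \<noteq> 0"
    obtain s r and k :: nat where sr: "s \<in> carrier P" "r \<in> carrier P"
      "lcoeff w [^] k \<odot>\<^bsub>P\<^esub> p = w \<otimes>\<^bsub>P\<^esub> s \<oplus>\<^bsub>P\<^esub> r" "r = \<zero>\<^bsub>P\<^esub> \<or> deg R r < deg R w"
      using long_div_theorem[OF wP(1) p(1) w0] by blast
    have sum: "e w \<otimes>\<^bsub>S\<^esub> e s \<oplus>\<^bsub>S\<^esub> e r = \<zero>\<^bsub>S\<^esub>"
      using arg_cong[OF sr(3), of e] p sr(1,2) pow(2)[OF wP(1) w0, of k] wP smult by simp
    have "e r = \<ominus>\<^bsub>S\<^esub> (e w \<otimes>\<^bsub>S\<^esub> e s)"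
      using sum wP sr by (simp add: S.minus_equality S.add.m_comm)
    also have "\<dots> = e q \<otimes>\<^bsub>S\<^esub> e (\<ominus>\<^bsub>P\<^esub> (v \<otimes>\<^bsub>P\<^esub> s))"
      using v q sr by (simp add: S.m_assoc S.r_minus)
    finally have er: "e r = e q \<otimes>\<^bsub>S\<^esub> e (\<ominus>\<^bsub>P\<^esub> (v \<otimes>\<^bsub>P\<^esub> s))" .
    have "e r = \<zero>\<^bsub>S\<^esub>"
    proof (rule ccontr)
      assume nz: "e r \<noteq> \<zero>\<^bsub>S\<^esub>"
      then have "W r"
        unfolding W_def using er sr(1,2) v(1)
        by (intro conjI bexI[of _ "\<ominus>\<^bsub>P\<^esub> (v \<otimes>\<^bsub>P\<^esub> s)"]) simp_all
      then show False using wmin[of r] sr(4) nz by auto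
    qed
    then have r0: "r = \<zero>\<^bsub>P\<^esub>" using min sr degwp by force
    have "e s = \<zero>\<^bsub>S\<^esub>" using sum \<open>e r = \<zero>\<^bsub>S\<^esub>\<close> wP sr by (simp add: S.integral_iff)
    have ws: "w \<otimes>\<^bsub>P\<^esub> s = lcoeff w [^] k \<odot>\<^bsub>P\<^esub> p" using sr r0 wP by simp
    have "lcoeff w [^] k \<odot>\<^bsub>P\<^esub> p \<noteq> \<zero>\<^bsub>P\<^esub>"
      using pow[OF wP(1) w0, of k] p
      by (metis deg_smult deg_zero deg_pos_of_relation[OF e inj] neq0_conv)
    then have s0: "s \<noteq> \<zero>\<^bsub>P\<^esub>" using ws wP by auto
    have "deg R w + deg R s = deg R p"
      using arg_cong[OF ws, of "deg R"] pow[OF wP(1) w0, of k] p wP w0 sr(1) s0 by simp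
    then have "deg R s < deg R p" using pos by simp
    then show False using min sr \<open>e s = \<zero>\<^bsub>S\<^esub>\<close> s0 by blast
  qed
  then have weq: "w = up_ring.monom P (up_ring.coeff P w 0) 0"
    using wP deg_zero_impl_monom by simp
  show ?thesis
    using weq w0 v wP by (metis coeff_closed monom_zero)
qed

section \<open>Roots of specialised polynomials\<close>

text \<open>A bridge between two representations of polynomials: lists with the leading coefficient
  in front, which explains \<open>rev\<close>, and coefficient functions evaluated by a finite
  sum.\<close>

lemma (in ring) eval_coeff_list:
  assumes "\<And>i. i \<le> n \<Longrightarrow> c i \<in> carrier R" "x \<in> carrier R"
  shows "eval (map c (rev [0..<Suc n])) x = (\<Oplus>i\<in>{..n}. c i \<otimes> x [^] i)"
  using assms
proof (induct n)
  case (Suc n)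
  have "eval (map c (rev [0..<Suc (Suc n)])) x =
    c (Suc n) \<otimes> x [^] Suc n \<oplus> eval (map c (rev [0..<Suc n])) x" by simp
  also have "\<dots> = c (Suc n) \<otimes> x [^] Suc n \<oplus> (\<Oplus>i\<in>{..n}. c i \<otimes> x [^] i)"
    using Suc by simp
  also have "\<dots> = (\<Oplus>i\<in>{..Suc n}. c i \<otimes> x [^] i)"
    using Suc by (intro finsum_Suc[symmetric]) auto
  finally show ?case .
qed simp

text \<open>Applying \<open>\<phi>\<close> to the coefficients might lower the degree, even to zero.
  The hypothesis \<open>lc\<close> prevents this, and it also makes the coefficient list a
  legitimate element of \<open>poly_ring L\<close>, whose lists must not start with zero.\<close>

lemma (in algebraically_closed) exists_eval_zero:
  assumes "UP_pre_univ_prop R L \<phi>" "p \<in> carrier (UP R)" "0 < deg R p"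
    and lc: "\<phi> (up_ring.coeff (UP R) p (deg R p)) \<noteq> \<zero>"
  obtains b where "b \<in> carrier L" "UnivPoly.eval R L \<phi> b p = \<zero>"
proof -
  interpret U: UP_pre_univ_prop R L \<phi> "UP R" using assms(1) by simp
  define c where "c i = \<phi> (up_ring.coeff (UP R) p i)" for i
  define cs where "cs = map c (rev [0..<Suc (deg R p)])"
  have c: "c i \<in> carrier L" for i using assms(2) by (simp add: c_def)
  have "cs \<in> carrier (poly_ring L)"
    unfolding univ_poly_carrier[symmetric] polynomial_def
    using c lc by (auto simp: cs_def c_def)
  moreover have "degree cs > 0" using assms by (simp add: cs_def)
  ultimately have "roots cs \<noteq> {#}"
    using roots_over_carrier unfolding splitted_def by fastforce
  then obtain b where "b \<in># roots cs" by blast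
  then have b: "b \<in> carrier L" "eval cs b = \<zero>"
    using roots_mem_iff_is_root[OF \<open>cs \<in> _\<close>] unfolding is_root_def by auto
  have "UnivPoly.eval R L \<phi> b p = eval cs b"
    unfolding cs_def using b c assms(2)
    by (subst eval_coeff_list) (auto simp: U.eval_on_carrier c_def)
  then show ?thesis using that b by simp
qed

section \<open>Extending a homomorphism by one generator and by finitely many\<close>

text \<open>The classical extension lemma from which Zariski's lemma and the Nullstellensatz can be
  derived. The element \<open>c\<close> depends on \<open>a\<close> and \<open>f\<close> but not on
  \<open>\<phi>\<close>, so it can be handed to the preceding step as the new element to be kept
  nonzero.\<close>

lemma ring_hom_extend_simple:
  assumes F: "field F" and K: "subring K F" and a: "a \<in> carrier F"
    and L: "algebraically_closed L"
    and f: "f \<in> ring.simple_extension F K a" "f \<noteq> \<zero>\<^bsub>F\<^esub>"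
  shows "\<exists>c\<in>K. c \<noteq> \<zero>\<^bsub>F\<^esub> \<and> (\<forall>\<phi>\<in>ring_hom (F\<lparr>carrier := K\<rparr>) L. \<phi> c \<noteq> \<zero>\<^bsub>L\<^esub> \<longrightarrow>
    (\<exists>\<psi>\<in>ring_hom (F\<lparr>carrier := ring.simple_extension F K a\<rparr>) L.
      (\<forall>x\<in>K. \<psi> x = \<phi> x) \<and> \<psi> f \<noteq> \<zero>\<^bsub>L\<^esub>))"
proof -
  interpret F: field F by (rule F)
  interpret L: algebraically_closed L by (rule L)
  note KF = subringE(1)[OF K]
  define R where "R = F\<lparr>carrier := K\<rparr>"
  have R_simps: "carrier R = K" "\<zero>\<^bsub>R\<^esub> = \<zero>\<^bsub>F\<^esub>" "\<one>\<^bsub>R\<^esub> = \<one>\<^bsub>F\<^esub>"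
    by (simp_all add: R_def)
  have "domain R"
    unfolding R_def using F.subring_is_domain[OF K] by simp
  then interpret U: UP_domain R "UP R"
    by (simp add: UP_domain_def)
  have id: "id \<in> ring_hom R F"
    using KF by (auto simp: R_def ring_hom_def)
  interpret E: UP_pre_univ_prop R F id "UP R"
    using UP_pre_univ_propI[OF U.R.cring_axioms F.cring_axioms id] by simp
  define e where "e = UnivPoly.eval R F id a"
  have e_hom: "e \<in> ring_hom (UP R) F"
    unfolding e_def by (rule E.eval_ring_hom[OF a])
  interpret e: ring_hom_ring "UP R" F e
    using e_hom by (rule ring_hom_ringI2[OF U.UP_ring F.ring_axioms])
  have e_const: "e (up_ring.monom (UP R) c 0) = c" if "c \<in> K" for c
    unfolding e_def using E.eval_const[OF a, of c] that by (simp add: R_simps)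
  have e_X: "e (up_ring.monom (UP R) \<one>\<^bsub>F\<^esub> 1) = a"
    unfolding e_def using E.eval_monom1[OF a] by (simp add: R_simps)
  \<comment> \<open>Horner's scheme: if \<open>p\<close> has value \<open>k1\<close>, then
    multiplying by the variable and adding the constant \<open>k2\<close> gives the next element of
    the simple extension.\<close>
  have img: "F.simple_extension K a \<subseteq> e ` carrier (UP R)"
  proof
    fix z assume "z \<in> F.simple_extension K a"
    then show "z \<in> e ` carrier (UP R)"
    proof induct
      case zero
      show ?case using e.hom_zero by (intro image_eqI[of _ _ "\<zero>\<^bsub>UP R\<^esub>"]) simp_all
    next
      case (lin k1 k2)
      then obtain p where "p \<in> carrier (UP R)" "k1 = e p" by blast
      then show ?case
        using lin(3) e_const[OF lin(3)] e_X subringE(3)[OF K]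
        by (intro image_eqI[of _ _ "p \<otimes>\<^bsub>UP R\<^esub> up_ring.monom (UP R) \<one>\<^bsub>F\<^esub> 1 \<oplus>\<^bsub>UP R\<^esub> up_ring.monom (UP R) k2 0"])
          (simp_all add: R_simps)
    qed
  qed
  obtain q where q: "q \<in> carrier (UP R)" "f = e q"
    using img f(1) by auto
  \<comment> \<open>Sending \<open>a\<close> to \<open>b\<close> extends \<open>\<phi>\<close> as
    soon as \<open>b\<close> satisfies every relation that \<open>a\<close> satisfies over
    \<open>K\<close>.\<close>
  have extend: "\<exists>\<psi>\<in>ring_hom (F\<lparr>carrier := F.simple_extension K a\<rparr>) L.
      (\<forall>p\<in>carrier (UP R). e p \<in> F.simple_extension K a \<longrightarrow> \<psi> (e p) = UnivPoly.eval R L \<phi> b p) \<and>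
      (\<forall>x\<in>K. \<psi> x = \<phi> x)"
    if \<phi>: "\<phi> \<in> ring_hom R L" and b: "b \<in> carrier L"
      and ker: "\<And>p. p \<in> carrier (UP R) \<Longrightarrow> e p = \<zero>\<^bsub>F\<^esub> \<Longrightarrow> UnivPoly.eval R L \<phi> b p = \<zero>\<^bsub>L\<^esub>"
    for \<phi> b
  proof -
    interpret G: UP_pre_univ_prop R L \<phi> "UP R"
      using UP_pre_univ_propI[OF U.R.cring_axioms L.cring_axioms \<phi>] by simp
    have g: "ring_hom_ring (UP R) L (UnivPoly.eval R L \<phi> b)"
      using G.eval_ring_hom[OF b] by (rule ring_hom_ringI2[OF U.UP_ring L.ring_axioms])
    obtain \<psi> where \<psi>: "\<psi> \<in> ring_hom (F\<lparr>carrier := F.simple_extension K a\<rparr>) L"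
      "\<And>p. p \<in> carrier (UP R) \<Longrightarrow> \<psi> (e p) = UnivPoly.eval R L \<phi> b p"
      using ring_hom_factor[OF e.ring_hom_ring_axioms g ker img] by blast
    have "\<psi> x = \<phi> x" if "x \<in> K" for x
      using \<psi>(2)[of "up_ring.monom (UP R) x 0"] that e_const[OF that] G.eval_const[OF b, of x]
      by (simp add: R_simps)
    then show ?thesis using \<psi> by blast
  qed
  \<comment> \<open>Pseudo-division introduces powers of a leading coefficient; they can be
    cancelled in \<open>L\<close> because they stay nonzero there.\<close>
  have pow_nz: "c [^]\<^bsub>R\<^esub> (k::nat) \<in> K" "\<phi> c \<noteq> \<zero>\<^bsub>L\<^esub> \<Longrightarrow> \<phi> (c [^]\<^bsub>R\<^esub> k) \<noteq> \<zero>\<^bsub>L\<^esub>"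
    if "\<phi> \<in> ring_hom R L" "c \<in> K" for \<phi> c k
  proof -
    interpret \<phi>: ring_hom_cring R L \<phi>
      using that(1) by (intro ring_hom_cringI U.R.cring_axioms L.cring_axioms)
    show "c [^]\<^bsub>R\<^esub> (k::nat) \<in> K"
      using U.R.nat_pow_closed[of c k] that by (simp add: R_simps)
    assume nz: "\<phi> c \<noteq> \<zero>\<^bsub>L\<^esub>"
    have "\<phi> c \<in> carrier L" using that \<phi>.hom_closed by (simp add: R_simps)
    then have "\<phi> c [^]\<^bsub>L\<^esub> k \<noteq> \<zero>\<^bsub>L\<^esub>"
      using nz by (induct k) (auto simp: L.integral_iff)
    then show "\<phi> (c [^]\<^bsub>R\<^esub> k) \<noteq> \<zero>\<^bsub>L\<^esub>"
      using that \<phi>.hom_pow by (simp add: R_simps)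
  qed
  show ?thesis
  \<comment> \<open>The case distinction is whether \<open>a\<close> is algebraic or transcendental
    over the fraction field of \<open>K\<close>.\<close>
  proof (cases "\<exists>p\<in>carrier (UP R). p \<noteq> \<zero>\<^bsub>UP R\<^esub> \<and> e p = \<zero>\<^bsub>F\<^esub>")
    case True
    then obtain p0 where p0: "p0 \<in> carrier (UP R) \<and> p0 \<noteq> \<zero>\<^bsub>UP R\<^esub> \<and> e p0 = \<zero>\<^bsub>F\<^esub>"
      by blast
    obtain p where p: "p \<in> carrier (UP R)" "p \<noteq> \<zero>\<^bsub>UP R\<^esub>" "e p = \<zero>\<^bsub>F\<^esub>"
      and pmin: "\<And>r. r \<in> carrier (UP R) \<Longrightarrow> e r = \<zero>\<^bsub>F\<^esub> \<Longrightarrow> deg R r < deg R p \<Longrightarrow> r = \<zero>\<^bsub>UP R\<^esub>"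
      using ex_has_least_nat[of "\<lambda>p. p \<in> carrier (UP R) \<and> p \<noteq> \<zero>\<^bsub>UP R\<^esub> \<and> e p = \<zero>\<^bsub>F\<^esub>" p0 "deg R", OF p0]
      by (auto simp: not_less[symmetric])
    have inj: "c = \<zero>\<^bsub>R\<^esub>" if "c \<in> carrier R" "e (up_ring.monom (UP R) c 0) = \<zero>\<^bsub>F\<^esub>" for c
      using that e_const by (simp add: R_simps)
    \<comment> \<open>Here \<open>f\<close> divides a nonzero element \<open>c\<close> of
      \<open>K\<close>, with cofactor \<open>e v\<close>. After specialisation the image of
      \<open>f\<close> divides \<open>\<phi> c\<close>, so it is enough that \<open>\<phi> c\<close>
      is nonzero.\<close>
    obtain c v where cv: "c \<in> K" "v \<in> carrier (UP R)" "c \<noteq> \<zero>\<^bsub>F\<^esub>" "c = f \<otimes>\<^bsub>F\<^esub> e v"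
    proof -
      have "e q \<noteq> \<zero>\<^bsub>F\<^esub>" using f(2) q(2) by simp
      from U.minimal_relation_bezout[OF F.domain_axioms e_hom inj p pmin q(1) this]
      obtain c v where "c \<in> K" "v \<in> carrier (UP R)" "c \<noteq> \<zero>\<^bsub>F\<^esub>"
        "e (up_ring.monom (UP R) c 0) = e q \<otimes>\<^bsub>F\<^esub> e v"
        unfolding R_simps by blast
      then show ?thesis using that e_const q(2) by simp
    qed
    have dp: "0 < deg R p"
      using U.deg_pos_of_relation[OF e_hom inj p] .
    define l where "l = up_ring.coeff (UP R) p (deg R p)"
    have l: "l \<in> K" "l \<noteq> \<zero>\<^bsub>F\<^esub>"
      using U.lcoeff_closed[OF p(1)] U.lcoeff_nonzero2[OF p(1,2)] by (simp_all add: l_def R_simps)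
    \<comment> \<open>The required element is the product of \<open>l\<close> and \<open>c\<close>:
      the factor \<open>l\<close> preserves the degree of \<open>p\<close>, hence a root, and
      \<open>c\<close> guards \<open>f\<close>.\<close>
    have "\<exists>\<psi>\<in>ring_hom (F\<lparr>carrier := F.simple_extension K a\<rparr>) L.
      (\<forall>x\<in>K. \<psi> x = \<phi> x) \<and> \<psi> f \<noteq> \<zero>\<^bsub>L\<^esub>"
      if \<phi>: "\<phi> \<in> ring_hom R L" and nz: "\<phi> (l \<otimes>\<^bsub>F\<^esub> c) \<noteq> \<zero>\<^bsub>L\<^esub>" for \<phi>
    proof -
      interpret \<phi>: ring_hom_cring R L \<phi>
        using \<phi> by (intro ring_hom_cringI U.R.cring_axioms L.cring_axioms)
      interpret G: UP_pre_univ_prop R L \<phi> "UP R"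
        using UP_pre_univ_propI[OF U.R.cring_axioms L.cring_axioms \<phi>] by simp
      have "\<phi> (l \<otimes>\<^bsub>R\<^esub> c) \<noteq> \<zero>\<^bsub>L\<^esub>" using nz by (simp add: R_def)
      then have lc: "\<phi> l \<noteq> \<zero>\<^bsub>L\<^esub>" "\<phi> c \<noteq> \<zero>\<^bsub>L\<^esub>"
        using l cv \<phi>.hom_closed by (auto simp: R_simps)
      obtain b where b: "b \<in> carrier L" "UnivPoly.eval R L \<phi> b p = \<zero>\<^bsub>L\<^esub>"
        using L.exists_eval_zero[OF G.UP_pre_univ_prop_axioms p(1) dp] lc(1) by (auto simp: l_def)
      define g where "g = UnivPoly.eval R L \<phi> b"
      interpret g: ring_hom_ring "UP R" L g
        unfolding g_def
        using G.eval_ring_hom[OF b(1)] by (rule ring_hom_ringI2[OF U.UP_ring L.ring_axioms])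
      \<comment> \<open>By choice of \<open>b\<close> only \<open>p\<close> is known to be killed by
        \<open>g\<close>. Pseudo-division of a relation \<open>r\<close> by \<open>p\<close> leaves
        a relation of smaller degree, hence zero, so a power of \<open>l\<close> times
        \<open>r\<close> is a multiple of \<open>p\<close>; the power of \<open>\<phi> l\<close>
        cancels in \<open>L\<close>.\<close>
      have "g r = \<zero>\<^bsub>L\<^esub>" if r: "r \<in> carrier (UP R)" "e r = \<zero>\<^bsub>F\<^esub>" for r
      proof -
        obtain s t and k :: nat where st: "s \<in> carrier (UP R)" "t \<in> carrier (UP R)"
          "l [^]\<^bsub>R\<^esub> k \<odot>\<^bsub>UP R\<^esub> r = p \<otimes>\<^bsub>UP R\<^esub> s \<oplus>\<^bsub>UP R\<^esub> t" "t = \<zero>\<^bsub>UP R\<^esub> \<or> deg R t < deg R p"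
          using U.long_div_theorem[OF p(1) r(1) p(2)] unfolding l_def by blast
        have lk: "l [^]\<^bsub>R\<^esub> k \<in> carrier R" using pow_nz(1)[OF \<phi> l(1)] by (simp add: R_simps)
        have st': "up_ring.monom (UP R) (l [^]\<^bsub>R\<^esub> k) 0 \<otimes>\<^bsub>UP R\<^esub> r = p \<otimes>\<^bsub>UP R\<^esub> s \<oplus>\<^bsub>UP R\<^esub> t"
          using st(3) U.monom_mult_is_smult[OF lk r(1)] by simp
        have "e t = \<zero>\<^bsub>F\<^esub>"
          using arg_cong[OF st', of e] p st(1,2) r lk by simp
        then have "t = \<zero>\<^bsub>UP R\<^esub>" using pmin st by blast
        then have "\<phi> (l [^]\<^bsub>R\<^esub> k) \<otimes>\<^bsub>L\<^esub> g r = \<zero>\<^bsub>L\<^esub>"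
          using arg_cong[OF st', of g] p st(1) r(1) lk b G.eval_const[OF b(1) lk] by (simp add: g_def[symmetric])
        then show ?thesis
          using pow_nz(2)[OF \<phi> l(1) lc(1), of k] lk r(1) by (simp add: L.integral_iff)
      qed
      then obtain \<psi> where \<psi>: "\<psi> \<in> ring_hom (F\<lparr>carrier := F.simple_extension K a\<rparr>) L"
        "\<And>p. p \<in> carrier (UP R) \<Longrightarrow> e p \<in> F.simple_extension K a \<Longrightarrow> \<psi> (e p) = g p" "\<And>x. x \<in> K \<Longrightarrow> \<psi> x = \<phi> x"
        using extend[OF \<phi> b(1)] unfolding g_def by blast
      \<comment> \<open>The identity between \<open>c\<close> and \<open>f\<close> times
        \<open>e v\<close> is itself a relation of \<open>a\<close>, so \<open>g\<close> respects
        it.\<close>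
      have "\<phi> c = g q \<otimes>\<^bsub>L\<^esub> g v"
      proof -
        have "e (up_ring.monom (UP R) c 0 \<ominus>\<^bsub>UP R\<^esub> q \<otimes>\<^bsub>UP R\<^esub> v) = \<zero>\<^bsub>F\<^esub>"
          using q cv(1,2) e_const[OF cv(1)] cv(4)
          by (simp add: a_minus_def F.r_neg R_simps)
        then have "g (up_ring.monom (UP R) c 0 \<ominus>\<^bsub>UP R\<^esub> q \<otimes>\<^bsub>UP R\<^esub> v) = \<zero>\<^bsub>L\<^esub>"
          using \<open>\<And>r. r \<in> carrier (UP R) \<Longrightarrow> e r = \<zero>\<^bsub>F\<^esub> \<Longrightarrow> g r = \<zero>\<^bsub>L\<^esub>\<close> q cv(1,2)
          by (simp add: R_simps)
        then have "\<phi> c \<ominus>\<^bsub>L\<^esub> g q \<otimes>\<^bsub>L\<^esub> g v = \<zero>\<^bsub>L\<^esub>"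
          using q cv(1,2) G.eval_const[OF b(1), of c] by (simp add: a_minus_def R_simps g_def[symmetric])
        then show ?thesis
          using q cv(1,2) \<phi>.hom_closed[of c] by (simp add: R_simps)
      qed
      then have "g q \<noteq> \<zero>\<^bsub>L\<^esub>" using lc(2) cv(2) by auto
      then have "\<psi> f \<noteq> \<zero>\<^bsub>L\<^esub>" using \<psi>(2)[OF q(1)] q(2) f(1) by simp
      then show ?thesis using \<psi>(1,3) by blast
    qed
    moreover have "l \<otimes>\<^bsub>F\<^esub> c \<in> K" "l \<otimes>\<^bsub>F\<^esub> c \<noteq> \<zero>\<^bsub>F\<^esub>"
      using l cv(1,3) subringE(6)[OF K] F.integral_iff[of l c] subsetD[OF KF] by auto
    ultimately show ?thesis
      unfolding R_def by blast
  next
    case False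
    then have inj: "r = \<zero>\<^bsub>UP R\<^esub>" if "r \<in> carrier (UP R)" "e r = \<zero>\<^bsub>F\<^esub>" for r
      using that by blast
    \<comment> \<open>Without relations every \<open>b\<close> is admissible, and only the value of
      \<open>q\<close> at \<open>b\<close> has to be nonzero. The leading coefficient of
      \<open>q\<close> is the element to preserve.\<close>
    define l where "l = up_ring.coeff (UP R) q (deg R q)"
    have q0: "q \<noteq> \<zero>\<^bsub>UP R\<^esub>" using q f by auto
    have l: "l \<in> K" "l \<noteq> \<zero>\<^bsub>F\<^esub>"
      using U.lcoeff_closed[OF q(1)] U.lcoeff_nonzero2[OF q(1) q0] by (simp_all add: l_def R_simps)
    have "\<exists>\<psi>\<in>ring_hom (F\<lparr>carrier := F.simple_extension K a\<rparr>) L.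
      (\<forall>x\<in>K. \<psi> x = \<phi> x) \<and> \<psi> f \<noteq> \<zero>\<^bsub>L\<^esub>"
      if \<phi>: "\<phi> \<in> ring_hom R L" and nz: "\<phi> l \<noteq> \<zero>\<^bsub>L\<^esub>" for \<phi>
    proof -
      interpret G: UP_pre_univ_prop R L \<phi> "UP R"
        using UP_pre_univ_propI[OF U.R.cring_axioms L.cring_axioms \<phi>] by simp
      have "\<exists>b\<in>carrier L. UnivPoly.eval R L \<phi> b q \<noteq> \<zero>\<^bsub>L\<^esub>"
      proof (cases "deg R q = 0")
        case True
        then have "q = up_ring.monom (UP R) l 0"
          using U.deg_zero_impl_monom[OF q(1)] by (simp add: l_def)
        then have "UnivPoly.eval R L \<phi> \<zero>\<^bsub>L\<^esub> q = \<phi> l"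
          using G.eval_const[of "\<zero>\<^bsub>L\<^esub>" l] l by (simp add: R_simps)
        then show ?thesis using nz by (intro bexI[of _ "\<zero>\<^bsub>L\<^esub>"]) simp_all
      next
        case dq: False
        \<comment> \<open>A non-root of \<open>q\<close> is obtained as a root of \<open>q\<close>
          minus one, where \<open>q\<close> takes the value one. As \<open>q\<close> has positive
          degree, subtracting one leaves its leading coefficient intact.\<close>
        define q' where "q' = q \<ominus>\<^bsub>UP R\<^esub> \<one>\<^bsub>UP R\<^esub>"
        have q': "q' \<in> carrier (UP R)" using q by (simp add: q'_def)
        have cq': "up_ring.coeff (UP R) q' i = up_ring.coeff (UP R) q i" if "0 < i" for i
          using q that by (simp add: q'_def a_minus_def)
        have dq': "deg R q' = deg R q"
        proof (rule antisym)
          show "deg R q' \<le> deg R q"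
            using cq' U.deg_aboveD[OF _ q(1)] by (intro U.deg_aboveI[OF _ q']) simp
          show "deg R q \<le> deg R q'"
            using cq' U.lcoeff_nonzero2[OF q(1) q0] by (intro U.deg_belowI[OF _ q']) simp
        qed
        obtain b where b: "b \<in> carrier L" "UnivPoly.eval R L \<phi> b q' = \<zero>\<^bsub>L\<^esub>"
          using L.exists_eval_zero[OF G.UP_pre_univ_prop_axioms q'] dq nz cq'[of "deg R q"]
          by (auto simp: l_def dq')
        interpret g: ring_hom_ring "UP R" L "UnivPoly.eval R L \<phi> b"
          using G.eval_ring_hom[OF b(1)] by (rule ring_hom_ringI2[OF U.UP_ring L.ring_axioms])
        have "UnivPoly.eval R L \<phi> b q \<ominus>\<^bsub>L\<^esub> \<one>\<^bsub>L\<^esub> = \<zero>\<^bsub>L\<^esub>"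
          using b(2) q(1) by (simp add: q'_def a_minus_def)
        then have "UnivPoly.eval R L \<phi> b q = \<one>\<^bsub>L\<^esub>"
          using q(1) by simp
        then show ?thesis using b(1) by (intro bexI[of _ b]) simp_all
      qed
      then obtain b where b: "b \<in> carrier L" "UnivPoly.eval R L \<phi> b q \<noteq> \<zero>\<^bsub>L\<^esub>" by blast
      interpret g: ring_hom_ring "UP R" L "UnivPoly.eval R L \<phi> b"
        using G.eval_ring_hom[OF b(1)] by (rule ring_hom_ringI2[OF U.UP_ring L.ring_axioms])
      show ?thesis
      proof -
        have "UnivPoly.eval R L \<phi> b p = \<zero>\<^bsub>L\<^esub>" if "p \<in> carrier (UP R)" "e p = \<zero>\<^bsub>F\<^esub>" for p
          using inj[OF that] g.hom_zero by simp
        from extend[OF \<phi> b(1) this] show ?thesis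
          using b(2) q f(1) by auto
      qed
    qed
    then show ?thesis
      using l unfolding R_def by blast
  qed
qed

text \<open>The induction is over all \<open>f\<close> at once: the step for the head of the list
  replaces \<open>f\<close> by an element \<open>c\<close> of the smaller ring, for which the
  hypothesis is then used. At the empty list, injectivity of \<open>\<phi>\<close> on
  \<open>K\<close> keeps any such element nonzero.\<close>

lemma ring_hom_extend_finite_extension:
  assumes F: "field F" and K: "subring K F" and xs: "set xs \<subseteq> carrier F"
    and L: "algebraically_closed L" and \<phi>: "\<phi> \<in> ring_hom (F\<lparr>carrier := K\<rparr>) L"
    and inj: "\<And>c. c \<in> K \<Longrightarrow> \<phi> c = \<zero>\<^bsub>L\<^esub> \<Longrightarrow> c = \<zero>\<^bsub>F\<^esub>"
    and f: "f \<in> ring.finite_extension F K xs" "f \<noteq> \<zero>\<^bsub>F\<^esub>"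
  shows "\<exists>\<psi>\<in>ring_hom (F\<lparr>carrier := ring.finite_extension F K xs\<rparr>) L.
    (\<forall>x\<in>K. \<psi> x = \<phi> x) \<and> \<psi> f \<noteq> \<zero>\<^bsub>L\<^esub>"
proof -
  interpret F: field F by (rule F)
  show ?thesis using xs f
  proof (induct xs arbitrary: f)
    case Nil
    then show ?case using \<phi> inj by auto
  next
    case (Cons a xs)
    let ?K = "F.finite_extension K xs"
    have sub: "subring ?K F" using Cons(2) F.finite_extension_is_subring[OF K] by simp
    have KK: "K \<subseteq> ?K" using Cons(2) F.finite_extension_incl[OF subringE(1)[OF K]] by simp
    obtain c where c: "c \<in> ?K" "c \<noteq> \<zero>\<^bsub>F\<^esub>"
      "\<And>\<phi>. \<phi> \<in> ring_hom (F\<lparr>carrier := ?K\<rparr>) L \<Longrightarrow> \<phi> c \<noteq> \<zero>\<^bsub>L\<^esub> \<Longrightarrow>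
        \<exists>\<psi>\<in>ring_hom (F\<lparr>carrier := F.simple_extension ?K a\<rparr>) L. (\<forall>x\<in>?K. \<psi> x = \<phi> x) \<and> \<psi> f \<noteq> \<zero>\<^bsub>L\<^esub>"
      using ring_hom_extend_simple[OF F sub _ L, of a f] Cons(2-4) by auto
    obtain \<psi> where \<psi>: "\<psi> \<in> ring_hom (F\<lparr>carrier := ?K\<rparr>) L" "\<And>x. x \<in> K \<Longrightarrow> \<psi> x = \<phi> x" "\<psi> c \<noteq> \<zero>\<^bsub>L\<^esub>"
      using Cons(1)[OF _ c(1,2)] Cons(2) by auto
    obtain \<psi>' where "\<psi>' \<in> ring_hom (F\<lparr>carrier := F.simple_extension ?K a\<rparr>) L"
      "\<And>x. x \<in> ?K \<Longrightarrow> \<psi>' x = \<psi> x" "\<psi>' f \<noteq> \<zero>\<^bsub>L\<^esub>"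
      using c(3)[OF \<psi>(1,3)] by auto
    then show ?case
      using \<psi>(2) KK by (intro bexI[of _ \<psi>']) auto
  qed
qed

section \<open>Isomorphisms of group algebras as matrices\<close>

lemma (in abelian_monoid) finsum_swap:
  assumes "finite A" "finite B" "\<And>a b. a \<in> A \<Longrightarrow> b \<in> B \<Longrightarrow> f a b \<in> carrier G"
  shows "(\<Oplus>a\<in>A. \<Oplus>b\<in>B. f a b) = (\<Oplus>b\<in>B. \<Oplus>a\<in>A. f a b)"
  using assms(1,3)
proof (induct A rule: finite_induct)
  case empty
  then show ?case by simp
next
  case (insert x A)
  have "(\<Oplus>a\<in>insert x A. \<Oplus>b\<in>B. f a b) = (\<Oplus>b\<in>B. f x b) \<oplus> (\<Oplus>a\<in>A. \<Oplus>b\<in>B. f a b)"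
    using insert by (intro finsum_insert) auto
  also have "\<dots> = (\<Oplus>b\<in>B. f x b \<oplus> (\<Oplus>a\<in>A. f a b))"
    using insert by (subst finsum_addf) auto
  also have "\<dots> = (\<Oplus>b\<in>B. \<Oplus>a\<in>insert x A. f a b)"
    using insert by (intro finsum_cong') (auto intro!: finsum_closed)
  finally show ?case .
qed

lemma (in semiring) finsum_delta:
  assumes "finite A" "i \<in> A" "f \<in> A \<rightarrow> carrier R"
  shows "(\<Oplus>j\<in>A. (if j = i then \<one> else \<zero>) \<otimes> f j) = f i"
    and "(\<Oplus>j\<in>A. f j \<otimes> (if j = i then \<one> else \<zero>)) = f i"
proof -
  have *: "(\<Oplus>j\<in>A. if i = j then f j else \<zero>) = f i"
    using assms by (intro finsum_singleton) auto
  show "(\<Oplus>j\<in>A. (if j = i then \<one> else \<zero>) \<otimes> f j) = f i"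
    unfolding *[symmetric] using assms by (intro finsum_cong') (auto simp: Pi_iff)
  show "(\<Oplus>j\<in>A. f j \<otimes> (if j = i then \<one> else \<zero>)) = f i"
    unfolding *[symmetric] using assms by (intro finsum_cong') (auto simp: Pi_iff)
qed

lemma (in group) finsum_translate:
  assumes "abelian_monoid K" "y \<in> carrier G" "f \<in> carrier G \<rightarrow> carrier K"
  shows "(\<Oplus>\<^bsub>K\<^esub>x\<in>carrier G. f x) = (\<Oplus>\<^bsub>K\<^esub>z\<in>carrier G. f (y \<otimes> z))"
proof -
  interpret K: abelian_monoid K by (rule assms(1))
  have "(\<otimes>) y ` carrier G = carrier G"
    using surj_const_mult[OF assms(2)] by simp
  moreover have "inj_on ((\<otimes>) y) (carrier G)"
    using assms(2) by (simp add: inj_on_multc inj_on_cmult)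
  ultimately show ?thesis
    using K.finsum_reindex[of f "(\<otimes>) y" "carrier G"] assms(3) by simp
qed

lemma group_algebra_simps:
  "carrier (group_algebra K G) = {f \<in> carrier G \<rightarrow>\<^sub>E carrier K. finite {x \<in> carrier G. f x \<noteq> \<zero>\<^bsub>K\<^esub>}}"
  "finite (carrier G) \<Longrightarrow> carrier (group_algebra K G) = carrier G \<rightarrow>\<^sub>E carrier K"
  "\<one>\<^bsub>group_algebra K G\<^esub> = (\<lambda>x\<in>carrier G. if x = \<one>\<^bsub>G\<^esub> then \<one>\<^bsub>K\<^esub> else \<zero>\<^bsub>K\<^esub>)"
  "f \<oplus>\<^bsub>group_algebra K G\<^esub> g = (\<lambda>x\<in>carrier G. f x \<oplus>\<^bsub>K\<^esub> g x)"
  "a \<odot>\<^bsub>group_algebra K G\<^esub> f = (\<lambda>x\<in>carrier G. a \<otimes>\<^bsub>K\<^esub> f x)"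
  by (auto simp: group_algebra_def)

text \<open>Terms outside the support of \<open>f\<close> vanish. Summing over the whole finite
  group frees the index set from \<open>f\<close>, which the later interchanges of sums
  require.\<close>

lemma group_algebra_mult:
  assumes "cring K" "group G" "finite (carrier G)"
    and "f \<in> carrier (group_algebra K G)" "g \<in> carrier (group_algebra K G)"
  shows "f \<otimes>\<^bsub>group_algebra K G\<^esub> g =
    (\<lambda>x\<in>carrier G. \<Oplus>\<^bsub>K\<^esub>y\<in>carrier G. f y \<otimes>\<^bsub>K\<^esub> g (inv\<^bsub>G\<^esub> y \<otimes>\<^bsub>G\<^esub> x))"
proof -
  interpret K: cring K by fact
  interpret G: group G by fact
  have fg: "f \<in> carrier G \<rightarrow> carrier K" "g \<in> carrier G \<rightarrow> carrier K"
    using assms(3-5) by (auto simp: group_algebra_simps)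
  have "(\<Oplus>\<^bsub>K\<^esub>y\<in>{y \<in> carrier G. f y \<noteq> \<zero>\<^bsub>K\<^esub>}. f y \<otimes>\<^bsub>K\<^esub> g (inv\<^bsub>G\<^esub> y \<otimes>\<^bsub>G\<^esub> x)) =
    (\<Oplus>\<^bsub>K\<^esub>y\<in>carrier G. f y \<otimes>\<^bsub>K\<^esub> g (inv\<^bsub>G\<^esub> y \<otimes>\<^bsub>G\<^esub> x))" if "x \<in> carrier G" for x
    using fg that assms(3)
    by (intro K.add.finprod_mono_neutral_cong_left) (auto simp: Pi_iff)
  then show ?thesis
    by (auto simp: group_algebra_def intro!: restrict_ext)
qed

text \<open>\<open>M g\<close> and \<open>N k\<close> are the coordinate vectors of the images of the basis elements
  \<open>g\<close> and \<open>k\<close> under an isomorphism \<open>KG \<rightarrow> KH\<close> and its inverse.\<close>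

definition group_algebra_iso_matrix ::
    "('k, 'm) ring_scheme \<Rightarrow> ('g, 'n) monoid_scheme \<Rightarrow> ('h, 'l) monoid_scheme
      \<Rightarrow> ('g \<Rightarrow> 'h \<Rightarrow> 'k) \<Rightarrow> ('h \<Rightarrow> 'g \<Rightarrow> 'k) \<Rightarrow> bool" where
  "group_algebra_iso_matrix K G H M N \<longleftrightarrow>
    (\<forall>g\<in>carrier G. \<forall>k\<in>carrier H. M g k \<in> carrier K) \<and>
    (\<forall>k\<in>carrier H. \<forall>g\<in>carrier G. N k g \<in> carrier K) \<and>
    (\<forall>g\<in>carrier G. \<forall>g'\<in>carrier G. \<forall>k\<in>carrier H. M (g \<otimes>\<^bsub>G\<^esub> g') k =
      (\<Oplus>\<^bsub>K\<^esub>w\<in>carrier H. M g w \<otimes>\<^bsub>K\<^esub> M g' (inv\<^bsub>H\<^esub> w \<otimes>\<^bsub>H\<^esub> k))) \<and>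
    (\<forall>k\<in>carrier H. M \<one>\<^bsub>G\<^esub> k = (if k = \<one>\<^bsub>H\<^esub> then \<one>\<^bsub>K\<^esub> else \<zero>\<^bsub>K\<^esub>)) \<and>
    (\<forall>g\<in>carrier G. \<forall>g'\<in>carrier G. (\<Oplus>\<^bsub>K\<^esub>k\<in>carrier H. M g k \<otimes>\<^bsub>K\<^esub> N k g') =
      (if g = g' then \<one>\<^bsub>K\<^esub> else \<zero>\<^bsub>K\<^esub>)) \<and>
    (\<forall>k\<in>carrier H. \<forall>k'\<in>carrier H. (\<Oplus>\<^bsub>K\<^esub>g\<in>carrier G. N k g \<otimes>\<^bsub>K\<^esub> M g k') =
      (if k = k' then \<one>\<^bsub>K\<^esub> else \<zero>\<^bsub>K\<^esub>))"

lemma (in ring_hom_cring) hom_finsum_mult: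
  assumes "\<And>x. x \<in> A \<Longrightarrow> a x \<in> carrier R" "\<And>x. x \<in> A \<Longrightarrow> b x \<in> carrier R"
  shows "h (\<Oplus>\<^bsub>R\<^esub>x\<in>A. a x \<otimes>\<^bsub>R\<^esub> b x) = (\<Oplus>\<^bsub>S\<^esub>x\<in>A. h (a x) \<otimes>\<^bsub>S\<^esub> h (b x))"
  using assms by (subst hom_finsum) (auto intro!: S.finsum_cong')

text \<open>All conditions are equations between sums of products of entries and the constants zero
  and one, so they pass through any ring homomorphism.\<close>

lemma group_algebra_iso_matrix_map:
  assumes "ring_hom_cring K L \<theta>" "group G" "group H" "group_algebra_iso_matrix K G H M N"
  shows "group_algebra_iso_matrix L G H (\<lambda>g k. \<theta> (M g k)) (\<lambda>k g. \<theta> (N k g))"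
proof -
  interpret \<theta>: ring_hom_cring K L \<theta> by fact
  interpret G: group G by fact
  interpret H: group H by fact
  have M: "M g k \<in> carrier K" "N k g \<in> carrier K" if "g \<in> carrier G" "k \<in> carrier H" for g k
    using assms(4) that by (auto simp: group_algebra_iso_matrix_def)
  note sum = \<theta>.hom_finsum_mult[symmetric]
  have "\<theta> (M (g \<otimes>\<^bsub>G\<^esub> g') k) =
      (\<Oplus>\<^bsub>L\<^esub>w\<in>carrier H. \<theta> (M g w) \<otimes>\<^bsub>L\<^esub> \<theta> (M g' (inv\<^bsub>H\<^esub> w \<otimes>\<^bsub>H\<^esub> k)))"
    if "g \<in> carrier G" "g' \<in> carrier G" "k \<in> carrier H" for g g' k
    using assms(4) that M by (subst sum) (auto simp: group_algebra_iso_matrix_def)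
  moreover have "(\<Oplus>\<^bsub>L\<^esub>k\<in>carrier H. \<theta> (M g k) \<otimes>\<^bsub>L\<^esub> \<theta> (N k g')) = (if g = g' then \<one>\<^bsub>L\<^esub> else \<zero>\<^bsub>L\<^esub>)"
    if "g \<in> carrier G" "g' \<in> carrier G" for g g'
    using assms(4) that M by (subst sum) (auto simp: group_algebra_iso_matrix_def)
  moreover have "(\<Oplus>\<^bsub>L\<^esub>g\<in>carrier G. \<theta> (N k g) \<otimes>\<^bsub>L\<^esub> \<theta> (M g k')) = (if k = k' then \<one>\<^bsub>L\<^esub> else \<zero>\<^bsub>L\<^esub>)"
    if "k \<in> carrier H" "k' \<in> carrier H" for k k'
    using assms(4) that M by (subst sum) (auto simp: group_algebra_iso_matrix_def)
  moreover have "\<theta> (M \<one>\<^bsub>G\<^esub> k) = (if k = \<one>\<^bsub>H\<^esub> then \<one>\<^bsub>L\<^esub> else \<zero>\<^bsub>L\<^esub>)" if "k \<in> carrier H" for k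
    using assms(4) that by (auto simp: group_algebra_iso_matrix_def)
  ultimately show ?thesis
    unfolding group_algebra_iso_matrix_def using M by auto
qed

section \<open>From a pair of matrices to an isomorphism\<close>

text \<open>Associativity of matrix multiplication for a row vector \<open>u\<close>, read off in
  the single column \<open>g'\<close> of the product of \<open>M\<close> and
  \<open>N\<close>.\<close>

lemma (in cring) finsum_inverse_matrix:
  assumes "finite A" "finite B" "g' \<in> A" "\<And>g. g \<in> A \<Longrightarrow> u g \<in> carrier R"
    and "\<And>g k. g \<in> A \<Longrightarrow> k \<in> B \<Longrightarrow> M g k \<in> carrier R"
    and "\<And>g k. g \<in> A \<Longrightarrow> k \<in> B \<Longrightarrow> N k g \<in> carrier R"
    and inv: "\<And>g. g \<in> A \<Longrightarrow> (\<Oplus>k\<in>B. M g k \<otimes> N k g') = (if g = g' then \<one> else \<zero>)"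
  shows "(\<Oplus>k\<in>B. (\<Oplus>g\<in>A. u g \<otimes> M g k) \<otimes> N k g') = u g'"
proof -
  have "(\<Oplus>k\<in>B. (\<Oplus>g\<in>A. u g \<otimes> M g k) \<otimes> N k g') = (\<Oplus>k\<in>B. \<Oplus>g\<in>A. u g \<otimes> (M g k \<otimes> N k g'))"
    using assms
    by (intro finsum_cong') (auto simp: finsum_ldistr m_assoc intro!: finsum_cong' finsum_closed)
  also have "\<dots> = (\<Oplus>g\<in>A. \<Oplus>k\<in>B. u g \<otimes> (M g k \<otimes> N k g'))"
    using assms by (intro finsum_swap) auto
  also have "\<dots> = (\<Oplus>g\<in>A. u g \<otimes> (if g = g' then \<one> else \<zero>))"
    using assms by (intro finsum_cong') (auto simp: finsum_rdistr[symmetric] simp flip: inv)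
  also have "\<dots> = u g'"
    using assms by (intro finsum_delta) auto
  finally show ?thesis .
qed

text \<open>The matrices are extended linearly to maps \<open>\<Phi>\<close> and
  \<open>\<Psi>\<close>, which are mutually inverse by the two matrix products. Multiplicativity on
  group elements extends bilinearly; with convolutions this becomes an interchange of triple
  sums.\<close>

lemma algebra_isomorphic_of_matrix:
  assumes "cring K" "group G" "finite (carrier G)" "group H" "finite (carrier H)"
    and iso: "group_algebra_iso_matrix K G H M N"
  shows "algebra_isomorphic K (group_algebra K G) (group_algebra K H)"
proof -
  interpret K: cring K by fact
  interpret G: group G by fact
  interpret H: group H by fact
  let ?A = "group_algebra K G" and ?B = "group_algebra K H"
  note cA = group_algebra_simps(2)[OF assms(3), of K] and cB = group_algebra_simps(2)[OF assms(5), of K]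
  have M: "M g k \<in> carrier K" "N k g \<in> carrier K" if "g \<in> carrier G" "k \<in> carrier H" for g k
    using iso that by (auto simp: group_algebra_iso_matrix_def)
  define \<Phi> where "\<Phi> u = (\<lambda>k\<in>carrier H. \<Oplus>\<^bsub>K\<^esub>g\<in>carrier G. u g \<otimes>\<^bsub>K\<^esub> M g k)" for u
  define \<Psi> where "\<Psi> v = (\<lambda>g\<in>carrier G. \<Oplus>\<^bsub>K\<^esub>k\<in>carrier H. v k \<otimes>\<^bsub>K\<^esub> N k g)" for v
  have \<Phi>_closed: "\<Phi> u \<in> carrier ?B" if "u \<in> carrier ?A" for u
    using that M by (auto simp: cA cB \<Phi>_def PiE_iff intro!: K.finsum_closed)
  have \<Psi>_closed: "\<Psi> v \<in> carrier ?A" if "v \<in> carrier ?B" for v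
    using that M by (auto simp: cA cB \<Psi>_def PiE_iff intro!: K.finsum_closed)
  have \<Psi>\<Phi>: "\<Psi> (\<Phi> u) = u" if u: "u \<in> carrier ?A" for u
  proof (rule extensionalityI)
    show "\<Psi> (\<Phi> u) \<in> extensional (carrier G)" "u \<in> extensional (carrier G)"
      using u by (auto simp: \<Psi>_def cA PiE_iff)
    fix g' assume g': "g' \<in> carrier G"
    have "\<Psi> (\<Phi> u) g' = (\<Oplus>\<^bsub>K\<^esub>k\<in>carrier H. (\<Oplus>\<^bsub>K\<^esub>g\<in>carrier G. u g \<otimes>\<^bsub>K\<^esub> M g k) \<otimes>\<^bsub>K\<^esub> N k g')"
      using g' u M unfolding \<Psi>_def \<Phi>_def
      by (auto simp: cA PiE_iff intro!: K.finsum_cong' K.finsum_closed)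
    also have "\<dots> = u g'"
      using g' u M iso assms(3,5)
      by (intro K.finsum_inverse_matrix) (auto simp: cA PiE_iff group_algebra_iso_matrix_def)
    finally show "\<Psi> (\<Phi> u) g' = u g'" .
  qed
  have \<Phi>\<Psi>: "\<Phi> (\<Psi> v) = v" if v: "v \<in> carrier ?B" for v
  proof (rule extensionalityI)
    show "\<Phi> (\<Psi> v) \<in> extensional (carrier H)" "v \<in> extensional (carrier H)"
      using v by (auto simp: \<Phi>_def cB PiE_iff)
    fix k' assume k': "k' \<in> carrier H"
    have "\<Phi> (\<Psi> v) k' = (\<Oplus>\<^bsub>K\<^esub>g\<in>carrier G. (\<Oplus>\<^bsub>K\<^esub>k\<in>carrier H. v k \<otimes>\<^bsub>K\<^esub> N k g) \<otimes>\<^bsub>K\<^esub> M g k')"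
      using k' v M unfolding \<Psi>_def \<Phi>_def
      by (auto simp: cB PiE_iff intro!: K.finsum_cong' K.finsum_closed)
    also have "\<dots> = v k'"
      using k' v M iso assms(3,5)
      by (intro K.finsum_inverse_matrix) (auto simp: cB PiE_iff group_algebra_iso_matrix_def)
    finally show "\<Phi> (\<Psi> v) k' = v k'" .
  qed
  have bij: "bij_betw \<Phi> (carrier ?A) (carrier ?B)"
    using \<Phi>_closed \<Psi>_closed \<Phi>\<Psi> \<Psi>\<Phi> by (intro bij_betwI[of _ _ _ \<Psi>]) auto
  have mult: "\<Phi> (u \<otimes>\<^bsub>?A\<^esub> v) = \<Phi> u \<otimes>\<^bsub>?B\<^esub> \<Phi> v" if uv: "u \<in> carrier ?A" "v \<in> carrier ?A" for u v
  proof -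
    have c: "u x \<in> carrier K" "v x \<in> carrier K" if "x \<in> carrier G" for x
      using uv that by (auto simp: cA PiE_iff)
    have key: "(\<Oplus>\<^bsub>K\<^esub>x\<in>carrier G. (\<Oplus>\<^bsub>K\<^esub>y\<in>carrier G. u y \<otimes>\<^bsub>K\<^esub> v (inv\<^bsub>G\<^esub> y \<otimes>\<^bsub>G\<^esub> x)) \<otimes>\<^bsub>K\<^esub> M x k) =
      (\<Oplus>\<^bsub>K\<^esub>w\<in>carrier H. (\<Oplus>\<^bsub>K\<^esub>y\<in>carrier G. u y \<otimes>\<^bsub>K\<^esub> M y w) \<otimes>\<^bsub>K\<^esub>
        (\<Oplus>\<^bsub>K\<^esub>z\<in>carrier G. v z \<otimes>\<^bsub>K\<^esub> M z (inv\<^bsub>H\<^esub> w \<otimes>\<^bsub>H\<^esub> k)))" (is "?l = ?r")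
      if k: "k \<in> carrier H" for k
    proof -
      have "?l = (\<Oplus>\<^bsub>K\<^esub>x\<in>carrier G. \<Oplus>\<^bsub>K\<^esub>y\<in>carrier G. u y \<otimes>\<^bsub>K\<^esub> v (inv\<^bsub>G\<^esub> y \<otimes>\<^bsub>G\<^esub> x) \<otimes>\<^bsub>K\<^esub> M x k)"
        using c M k assms(3) by (intro K.finsum_cong' K.finsum_ldistr) auto
      also have "\<dots> = (\<Oplus>\<^bsub>K\<^esub>y\<in>carrier G. \<Oplus>\<^bsub>K\<^esub>x\<in>carrier G. u y \<otimes>\<^bsub>K\<^esub> v (inv\<^bsub>G\<^esub> y \<otimes>\<^bsub>G\<^esub> x) \<otimes>\<^bsub>K\<^esub> M x k)"
        using c M k assms(3) by (intro K.finsum_swap) auto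
      also have "\<dots> = (\<Oplus>\<^bsub>K\<^esub>y\<in>carrier G. \<Oplus>\<^bsub>K\<^esub>z\<in>carrier G. \<Oplus>\<^bsub>K\<^esub>w\<in>carrier H.
          (u y \<otimes>\<^bsub>K\<^esub> M y w) \<otimes>\<^bsub>K\<^esub> (v z \<otimes>\<^bsub>K\<^esub> M z (inv\<^bsub>H\<^esub> w \<otimes>\<^bsub>H\<^esub> k)))"
      proof (rule K.finsum_cong'[OF refl])
        show "(\<lambda>y. \<Oplus>\<^bsub>K\<^esub>z\<in>carrier G. \<Oplus>\<^bsub>K\<^esub>w\<in>carrier H.
          (u y \<otimes>\<^bsub>K\<^esub> M y w) \<otimes>\<^bsub>K\<^esub> (v z \<otimes>\<^bsub>K\<^esub> M z (inv\<^bsub>H\<^esub> w \<otimes>\<^bsub>H\<^esub> k))) \<in> carrier G \<rightarrow> carrier K"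
          using c M k by (auto intro!: K.finsum_closed)
        \<comment> \<open>For fixed \<open>y\<close>, substituting the product of \<open>y\<close>
          and \<open>z\<close> for \<open>x\<close> turns the argument of \<open>v\<close> into
          \<open>z\<close>, and the matrix condition expands the row of the product into a
          convolution over \<open>H\<close>.\<close>
        fix y assume y: "y \<in> carrier G"
        have "(\<Oplus>\<^bsub>K\<^esub>x\<in>carrier G. u y \<otimes>\<^bsub>K\<^esub> v (inv\<^bsub>G\<^esub> y \<otimes>\<^bsub>G\<^esub> x) \<otimes>\<^bsub>K\<^esub> M x k) =
          (\<Oplus>\<^bsub>K\<^esub>z\<in>carrier G. u y \<otimes>\<^bsub>K\<^esub> v (inv\<^bsub>G\<^esub> y \<otimes>\<^bsub>G\<^esub> (y \<otimes>\<^bsub>G\<^esub> z)) \<otimes>\<^bsub>K\<^esub> M (y \<otimes>\<^bsub>G\<^esub> z) k)"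
          using c M k y by (intro G.finsum_translate K.abelian_monoid_axioms) auto
        also have "\<dots> = (\<Oplus>\<^bsub>K\<^esub>z\<in>carrier G. \<Oplus>\<^bsub>K\<^esub>w\<in>carrier H.
          (u y \<otimes>\<^bsub>K\<^esub> M y w) \<otimes>\<^bsub>K\<^esub> (v z \<otimes>\<^bsub>K\<^esub> M z (inv\<^bsub>H\<^esub> w \<otimes>\<^bsub>H\<^esub> k)))"
        proof (rule K.finsum_cong'[OF refl])
          show "(\<lambda>z. \<Oplus>\<^bsub>K\<^esub>w\<in>carrier H.
            (u y \<otimes>\<^bsub>K\<^esub> M y w) \<otimes>\<^bsub>K\<^esub> (v z \<otimes>\<^bsub>K\<^esub> M z (inv\<^bsub>H\<^esub> w \<otimes>\<^bsub>H\<^esub> k))) \<in> carrier G \<rightarrow> carrier K"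
            using c M k y by (auto intro!: K.finsum_closed)
          fix z assume z: "z \<in> carrier G"
          have "M (y \<otimes>\<^bsub>G\<^esub> z) k = (\<Oplus>\<^bsub>K\<^esub>w\<in>carrier H. M y w \<otimes>\<^bsub>K\<^esub> M z (inv\<^bsub>H\<^esub> w \<otimes>\<^bsub>H\<^esub> k))"
            using iso y z k unfolding group_algebra_iso_matrix_def by blast
          moreover have "inv\<^bsub>G\<^esub> y \<otimes>\<^bsub>G\<^esub> (y \<otimes>\<^bsub>G\<^esub> z) = z"
            using y z by (simp add: G.m_assoc[symmetric])
          ultimately have "u y \<otimes>\<^bsub>K\<^esub> v (inv\<^bsub>G\<^esub> y \<otimes>\<^bsub>G\<^esub> (y \<otimes>\<^bsub>G\<^esub> z)) \<otimes>\<^bsub>K\<^esub> M (y \<otimes>\<^bsub>G\<^esub> z) k =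
            (\<Oplus>\<^bsub>K\<^esub>w\<in>carrier H. (u y \<otimes>\<^bsub>K\<^esub> v z) \<otimes>\<^bsub>K\<^esub> (M y w \<otimes>\<^bsub>K\<^esub> M z (inv\<^bsub>H\<^esub> w \<otimes>\<^bsub>H\<^esub> k)))"
            using c M k y z assms(5) by (simp add: K.finsum_rdistr Pi_iff)
          also have "\<dots> = (\<Oplus>\<^bsub>K\<^esub>w\<in>carrier H.
            (u y \<otimes>\<^bsub>K\<^esub> M y w) \<otimes>\<^bsub>K\<^esub> (v z \<otimes>\<^bsub>K\<^esub> M z (inv\<^bsub>H\<^esub> w \<otimes>\<^bsub>H\<^esub> k)))"
            using c M k y z by (intro K.finsum_cong') (auto simp: K.m_ac)
          finally show "u y \<otimes>\<^bsub>K\<^esub> v (inv\<^bsub>G\<^esub> y \<otimes>\<^bsub>G\<^esub> (y \<otimes>\<^bsub>G\<^esub> z)) \<otimes>\<^bsub>K\<^esub> M (y \<otimes>\<^bsub>G\<^esub> z) k = \<dots>" .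
        qed
        finally show "(\<Oplus>\<^bsub>K\<^esub>x\<in>carrier G. u y \<otimes>\<^bsub>K\<^esub> v (inv\<^bsub>G\<^esub> y \<otimes>\<^bsub>G\<^esub> x) \<otimes>\<^bsub>K\<^esub> M x k) = \<dots>" .
      qed
      \<comment> \<open>The summation over \<open>w\<close> is moved outwards, so that the two inner
        sums separate into the coordinates of \<open>\<Phi> u\<close> and
        \<open>\<Phi> v\<close>.\<close>
      also have "\<dots> = (\<Oplus>\<^bsub>K\<^esub>y\<in>carrier G. \<Oplus>\<^bsub>K\<^esub>w\<in>carrier H. \<Oplus>\<^bsub>K\<^esub>z\<in>carrier G.
          (u y \<otimes>\<^bsub>K\<^esub> M y w) \<otimes>\<^bsub>K\<^esub> (v z \<otimes>\<^bsub>K\<^esub> M z (inv\<^bsub>H\<^esub> w \<otimes>\<^bsub>H\<^esub> k)))"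
        using c M k assms(3,5)
        by (intro K.finsum_cong' K.finsum_swap) (auto intro!: K.finsum_closed)
      also have "\<dots> = (\<Oplus>\<^bsub>K\<^esub>w\<in>carrier H. \<Oplus>\<^bsub>K\<^esub>y\<in>carrier G. \<Oplus>\<^bsub>K\<^esub>z\<in>carrier G.
          (u y \<otimes>\<^bsub>K\<^esub> M y w) \<otimes>\<^bsub>K\<^esub> (v z \<otimes>\<^bsub>K\<^esub> M z (inv\<^bsub>H\<^esub> w \<otimes>\<^bsub>H\<^esub> k)))"
        using c M k assms(3,5) by (intro K.finsum_swap) (auto intro!: K.finsum_closed)
      also have "\<dots> = ?r"
      proof (rule K.finsum_cong'[OF refl])
        show "(\<lambda>w. (\<Oplus>\<^bsub>K\<^esub>y\<in>carrier G. u y \<otimes>\<^bsub>K\<^esub> M y w) \<otimes>\<^bsub>K\<^esub>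
          (\<Oplus>\<^bsub>K\<^esub>z\<in>carrier G. v z \<otimes>\<^bsub>K\<^esub> M z (inv\<^bsub>H\<^esub> w \<otimes>\<^bsub>H\<^esub> k))) \<in> carrier H \<rightarrow> carrier K"
          using c M k by (auto intro!: K.finsum_closed)
        fix w assume w: "w \<in> carrier H"
        have "(\<Oplus>\<^bsub>K\<^esub>y\<in>carrier G. \<Oplus>\<^bsub>K\<^esub>z\<in>carrier G.
          (u y \<otimes>\<^bsub>K\<^esub> M y w) \<otimes>\<^bsub>K\<^esub> (v z \<otimes>\<^bsub>K\<^esub> M z (inv\<^bsub>H\<^esub> w \<otimes>\<^bsub>H\<^esub> k))) =
          (\<Oplus>\<^bsub>K\<^esub>y\<in>carrier G. (u y \<otimes>\<^bsub>K\<^esub> M y w) \<otimes>\<^bsub>K\<^esub>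
            (\<Oplus>\<^bsub>K\<^esub>z\<in>carrier G. v z \<otimes>\<^bsub>K\<^esub> M z (inv\<^bsub>H\<^esub> w \<otimes>\<^bsub>H\<^esub> k)))"
          using c M k w assms(3)
          by (intro K.finsum_cong' K.finsum_rdistr[symmetric]) (auto intro!: K.finsum_closed)
        also have "\<dots> = (\<Oplus>\<^bsub>K\<^esub>y\<in>carrier G. u y \<otimes>\<^bsub>K\<^esub> M y w) \<otimes>\<^bsub>K\<^esub>
          (\<Oplus>\<^bsub>K\<^esub>z\<in>carrier G. v z \<otimes>\<^bsub>K\<^esub> M z (inv\<^bsub>H\<^esub> w \<otimes>\<^bsub>H\<^esub> k))"
          using c M k w assms(3)
          by (intro K.finsum_ldistr[symmetric]) (auto intro!: K.finsum_closed)
        finally show "(\<Oplus>\<^bsub>K\<^esub>y\<in>carrier G. \<Oplus>\<^bsub>K\<^esub>z\<in>carrier G.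
          (u y \<otimes>\<^bsub>K\<^esub> M y w) \<otimes>\<^bsub>K\<^esub> (v z \<otimes>\<^bsub>K\<^esub> M z (inv\<^bsub>H\<^esub> w \<otimes>\<^bsub>H\<^esub> k))) = \<dots>" .
      qed
      finally show ?thesis .
    qed
    show ?thesis
    proof (rule extensionalityI[of _ "carrier H"])
      have B: "\<Phi> u \<otimes>\<^bsub>?B\<^esub> \<Phi> v = (\<lambda>k\<in>carrier H. \<Oplus>\<^bsub>K\<^esub>w\<in>carrier H. \<Phi> u w \<otimes>\<^bsub>K\<^esub> \<Phi> v (inv\<^bsub>H\<^esub> w \<otimes>\<^bsub>H\<^esub> k))"
        using assms uv \<Phi>_closed by (intro group_algebra_mult) auto
      show "\<Phi> (u \<otimes>\<^bsub>?A\<^esub> v) \<in> extensional (carrier H)" "\<Phi> u \<otimes>\<^bsub>?B\<^esub> \<Phi> v \<in> extensional (carrier H)"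
        by (simp_all add: B) (simp add: \<Phi>_def)
      fix k assume k: "k \<in> carrier H"
      have "\<Phi> (u \<otimes>\<^bsub>?A\<^esub> v) k =
        (\<Oplus>\<^bsub>K\<^esub>x\<in>carrier G. (\<Oplus>\<^bsub>K\<^esub>y\<in>carrier G. u y \<otimes>\<^bsub>K\<^esub> v (inv\<^bsub>G\<^esub> y \<otimes>\<^bsub>G\<^esub> x)) \<otimes>\<^bsub>K\<^esub> M x k)"
        unfolding group_algebra_mult[OF assms(1-3) uv] \<Phi>_def using k c M
        by (auto intro!: K.finsum_cong' K.finsum_closed)
      also have "\<dots> = (\<Phi> u \<otimes>\<^bsub>?B\<^esub> \<Phi> v) k"
        unfolding key[OF k] B using k c M
        by (auto simp: \<Phi>_def intro!: K.finsum_cong' K.finsum_closed)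
      finally show "\<Phi> (u \<otimes>\<^bsub>?A\<^esub> v) k = (\<Phi> u \<otimes>\<^bsub>?B\<^esub> \<Phi> v) k" .
    qed
  qed
  have add: "\<Phi> (u \<oplus>\<^bsub>?A\<^esub> v) = \<Phi> u \<oplus>\<^bsub>?B\<^esub> \<Phi> v" if uv: "u \<in> carrier ?A" "v \<in> carrier ?A" for u v
  proof -
    have "(\<Oplus>\<^bsub>K\<^esub>g\<in>carrier G. (u \<oplus>\<^bsub>?A\<^esub> v) g \<otimes>\<^bsub>K\<^esub> M g k) =
      (\<Oplus>\<^bsub>K\<^esub>g\<in>carrier G. u g \<otimes>\<^bsub>K\<^esub> M g k) \<oplus>\<^bsub>K\<^esub> (\<Oplus>\<^bsub>K\<^esub>g\<in>carrier G. v g \<otimes>\<^bsub>K\<^esub> M g k)"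
      if "k \<in> carrier H" for k
    proof (subst K.finsum_addf[symmetric])
      show "(\<Oplus>\<^bsub>K\<^esub>g\<in>carrier G. (u \<oplus>\<^bsub>?A\<^esub> v) g \<otimes>\<^bsub>K\<^esub> M g k) =
        (\<Oplus>\<^bsub>K\<^esub>g\<in>carrier G. u g \<otimes>\<^bsub>K\<^esub> M g k \<oplus>\<^bsub>K\<^esub> v g \<otimes>\<^bsub>K\<^esub> M g k)"
        using uv M that
        by (intro K.finsum_cong') (auto simp: group_algebra_simps(4) cA PiE_iff K.l_distr)
    qed (use uv M that in \<open>auto simp: cA PiE_iff\<close>)
    then show ?thesis
      by (auto simp: \<Phi>_def group_algebra_simps(4)[where G = H] intro!: restrict_ext)
  qed
  have one: "\<Phi> \<one>\<^bsub>?A\<^esub> = \<one>\<^bsub>?B\<^esub>"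
  proof -
    have "(\<Oplus>\<^bsub>K\<^esub>g\<in>carrier G. \<one>\<^bsub>?A\<^esub> g \<otimes>\<^bsub>K\<^esub> M g k) = (if k = \<one>\<^bsub>H\<^esub> then \<one>\<^bsub>K\<^esub> else \<zero>\<^bsub>K\<^esub>)"
      if k: "k \<in> carrier H" for k
    proof -
      have "(\<Oplus>\<^bsub>K\<^esub>g\<in>carrier G. \<one>\<^bsub>?A\<^esub> g \<otimes>\<^bsub>K\<^esub> M g k) =
        (\<Oplus>\<^bsub>K\<^esub>g\<in>carrier G. (if g = \<one>\<^bsub>G\<^esub> then \<one>\<^bsub>K\<^esub> else \<zero>\<^bsub>K\<^esub>) \<otimes>\<^bsub>K\<^esub> M g k)"
        using M k by (intro K.finsum_cong') (auto simp: group_algebra_simps(3))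
      also have "\<dots> = M \<one>\<^bsub>G\<^esub> k"
        using M k assms(3) by (intro K.finsum_delta) auto
      finally show ?thesis
        using iso k unfolding group_algebra_iso_matrix_def by auto
    qed
    then show ?thesis
      by (auto simp: \<Phi>_def group_algebra_simps(3)[where G = H] intro!: restrict_ext)
  qed
  have smult: "\<Phi> (a \<odot>\<^bsub>?A\<^esub> u) = a \<odot>\<^bsub>?B\<^esub> \<Phi> u" if a: "a \<in> carrier K" "u \<in> carrier ?A" for a u
  proof -
    have "(\<Oplus>\<^bsub>K\<^esub>g\<in>carrier G. (a \<odot>\<^bsub>?A\<^esub> u) g \<otimes>\<^bsub>K\<^esub> M g k) =
      a \<otimes>\<^bsub>K\<^esub> (\<Oplus>\<^bsub>K\<^esub>g\<in>carrier G. u g \<otimes>\<^bsub>K\<^esub> M g k)" if "k \<in> carrier H" for k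
    proof (subst K.finsum_rdistr)
      show "(\<Oplus>\<^bsub>K\<^esub>g\<in>carrier G. (a \<odot>\<^bsub>?A\<^esub> u) g \<otimes>\<^bsub>K\<^esub> M g k) =
        (\<Oplus>\<^bsub>K\<^esub>g\<in>carrier G. a \<otimes>\<^bsub>K\<^esub> (u g \<otimes>\<^bsub>K\<^esub> M g k))"
        using a M that
        by (intro K.finsum_cong') (auto simp: group_algebra_simps(5) cA PiE_iff K.m_assoc)
    qed (use a M that assms(3) in \<open>auto simp: cA PiE_iff\<close>)
    then show ?thesis
      by (auto simp: \<Phi>_def group_algebra_simps(5)[where G = H] intro!: restrict_ext)
  qed
  have "\<Phi> \<in> algebra_iso K ?A ?B"
    unfolding algebra_iso_def ring_iso_def
    using bij mult add one smult \<Phi>_closed by (auto intro!: ring_hom_memI)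
  then show ?thesis
    by (auto simp: algebra_isomorphic_def)
qed

text \<open>Finite sums are defined relative to a carrier, so sums in the subring and in
  \<open>F\<close> are compared through the inclusion, a ring homomorphism.\<close>

lemma group_algebra_iso_matrix_subring:
  assumes "cring F" "subring K F" "group G" "group H" "group_algebra_iso_matrix F G H M N"
    and "\<And>g k. g \<in> carrier G \<Longrightarrow> k \<in> carrier H \<Longrightarrow> M g k \<in> K"
    and "\<And>g k. g \<in> carrier G \<Longrightarrow> k \<in> carrier H \<Longrightarrow> N k g \<in> K"
  shows "group_algebra_iso_matrix (F\<lparr>carrier := K\<rparr>) G H M N"
proof -
  interpret F: cring F by fact
  interpret G: group G by fact
  interpret H: group H by fact
  interpret id: ring_hom_cring "F\<lparr>carrier := K\<rparr>" F id
    using assms(2) F.subcring_iff[OF subringE(1)[OF assms(2)]] subringE(1)[OF assms(2)] F.cring_axioms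
    by (intro ring_hom_cringI)
      (auto simp: ring_hom_def intro: F.subcringI' F.subcring_iff[THEN iffD1])
  note sum = id.hom_finsum_mult[simplified]
  show ?thesis
    using assms(5) unfolding group_algebra_iso_matrix_def
    by (auto simp: assms(6,7) sum)
qed

section \<open>From an isomorphism to a pair of matrices\<close>

text \<open>The group element \<open>g\<close> viewed inside the group algebra. For \<open>g\<close>
  outside the group it is the zero function, so it lies in the algebra for every
  \<open>g\<close>.\<close>

definition group_algebra_basis ::
    "('k, 'm) ring_scheme \<Rightarrow> ('g, 'n) monoid_scheme \<Rightarrow> 'g \<Rightarrow> 'g \<Rightarrow> 'k" where
  "group_algebra_basis K G g = (\<lambda>x\<in>carrier G. if x = g then \<one>\<^bsub>K\<^esub> else \<zero>\<^bsub>K\<^esub>)"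

lemma group_algebra_basis_closed:
  assumes "ring K" "finite (carrier G)"
  shows "group_algebra_basis K G g \<in> carrier (group_algebra K G)"
proof -
  interpret ring K by fact
  show ?thesis using assms(2) by (auto simp: group_algebra_basis_def group_algebra_simps)
qed

lemma group_algebra_basis_mult:
  assumes "cring K" "group G" "finite (carrier G)" "g \<in> carrier G" "g' \<in> carrier G"
  shows "group_algebra_basis K G g \<otimes>\<^bsub>group_algebra K G\<^esub> group_algebra_basis K G g' =
    group_algebra_basis K G (g \<otimes>\<^bsub>G\<^esub> g')"
proof -
  interpret K: cring K by fact
  interpret G: group G by fact
  have "(\<Oplus>\<^bsub>K\<^esub>y\<in>carrier G. group_algebra_basis K G g y \<otimes>\<^bsub>K\<^esub> group_algebra_basis K G g' (inv\<^bsub>G\<^esub> y \<otimes>\<^bsub>G\<^esub> x)) =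
    (if x = g \<otimes>\<^bsub>G\<^esub> g' then \<one>\<^bsub>K\<^esub> else \<zero>\<^bsub>K\<^esub>)" if x: "x \<in> carrier G" for x
  proof -
    have "(\<Oplus>\<^bsub>K\<^esub>y\<in>carrier G. group_algebra_basis K G g y \<otimes>\<^bsub>K\<^esub> group_algebra_basis K G g' (inv\<^bsub>G\<^esub> y \<otimes>\<^bsub>G\<^esub> x)) =
      (\<Oplus>\<^bsub>K\<^esub>y\<in>carrier G. (if y = g then \<one>\<^bsub>K\<^esub> else \<zero>\<^bsub>K\<^esub>) \<otimes>\<^bsub>K\<^esub>
        group_algebra_basis K G g' (inv\<^bsub>G\<^esub> y \<otimes>\<^bsub>G\<^esub> x))"
      using x by (intro K.finsum_cong') (auto simp: group_algebra_basis_def)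
    also have "\<dots> = group_algebra_basis K G g' (inv\<^bsub>G\<^esub> g \<otimes>\<^bsub>G\<^esub> x)"
      using x assms by (intro K.finsum_delta) (auto simp: group_algebra_basis_def)
    also have "\<dots> = (if x = g \<otimes>\<^bsub>G\<^esub> g' then \<one>\<^bsub>K\<^esub> else \<zero>\<^bsub>K\<^esub>)"
      using x assms(4,5) by (auto simp: group_algebra_basis_def G.inv_solve_left' G.m_assoc[symmetric])
    finally show ?thesis .
  qed
  then show ?thesis
    using group_algebra_mult[OF assms(1-3), of "group_algebra_basis K G g" "group_algebra_basis K G g'"]
      group_algebra_basis_closed[OF K.ring_axioms assms(3)]
    by (auto simp: group_algebra_basis_def[of K G "g \<otimes>\<^bsub>G\<^esub> g'"] intro!: restrict_ext)
qed

text \<open>Only additivity and homogeneity are asked of \<open>h\<close>, so that the lemma serves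
  an isomorphism and its set-theoretic inverse alike. The induction builds \<open>f\<close> up from
  its truncations to subsets of the group.\<close>

lemma group_algebra_linear_expand:
  assumes "cring K" "finite (carrier G)" "finite (carrier H)"
    and closed: "\<And>u. u \<in> carrier (group_algebra K G) \<Longrightarrow> h u \<in> carrier (group_algebra K H)"
    and add: "\<And>u v. u \<in> carrier (group_algebra K G) \<Longrightarrow> v \<in> carrier (group_algebra K G) \<Longrightarrow>
      h (u \<oplus>\<^bsub>group_algebra K G\<^esub> v) = h u \<oplus>\<^bsub>group_algebra K H\<^esub> h v"
    and smult: "\<And>a u. a \<in> carrier K \<Longrightarrow> u \<in> carrier (group_algebra K G) \<Longrightarrow>
      h (a \<odot>\<^bsub>group_algebra K G\<^esub> u) = a \<odot>\<^bsub>group_algebra K H\<^esub> h u"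
    and f: "f \<in> carrier (group_algebra K G)" and k: "k \<in> carrier H"
  shows "h f k = (\<Oplus>\<^bsub>K\<^esub>g\<in>carrier G. f g \<otimes>\<^bsub>K\<^esub> h (group_algebra_basis K G g) k)"
proof -
  interpret K: cring K by fact
  let ?A = "group_algebra K G" and ?B = "group_algebra K H"
  note cA = group_algebra_simps(2)[OF assms(2), of K] and cB = group_algebra_simps(2)[OF assms(3), of K]
  have bas: "group_algebra_basis K G g \<in> carrier ?A" for g
    using group_algebra_basis_closed[OF K.ring_axioms assms(2)] .
  have hk: "h u k \<in> carrier K" if "u \<in> carrier ?A" for u
    using closed[OF that] k by (auto simp: cB PiE_iff)
  define tr where "tr S = (\<lambda>x\<in>carrier G. if x \<in> S then f x else \<zero>\<^bsub>K\<^esub>)" for S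
  have fc: "f g \<in> carrier K" if "g \<in> carrier G" for g using f that by (auto simp: cA PiE_iff)
  have tr: "tr S \<in> carrier ?A" for S
    using fc by (auto simp: cA tr_def)
  have "h (tr S) k = (\<Oplus>\<^bsub>K\<^esub>g\<in>S. f g \<otimes>\<^bsub>K\<^esub> h (group_algebra_basis K G g) k)"
    if "finite S" "S \<subseteq> carrier G" for S
    using that
  proof (induct S rule: finite_induct)
    case empty
    \<comment> \<open>That \<open>h\<close> preserves zero is not assumed; it follows from
      homogeneity, writing the zero function as a zero multiple of itself.\<close>
    have "tr {} = \<zero>\<^bsub>K\<^esub> \<odot>\<^bsub>?A\<^esub> tr {}"
      by (auto simp: tr_def group_algebra_simps intro!: restrict_ext)
    then have "h (tr {}) = \<zero>\<^bsub>K\<^esub> \<odot>\<^bsub>?B\<^esub> h (tr {})"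
      using smult[OF K.zero_closed tr[of "{}"]] by simp
    then have "h (tr {}) k = (\<zero>\<^bsub>K\<^esub> \<odot>\<^bsub>?B\<^esub> h (tr {})) k"
      by (rule fun_cong)
    then show ?case
      using hk[OF tr] k by (simp add: group_algebra_simps)
  next
    case (insert g S)
    have "tr (insert g S) = f g \<odot>\<^bsub>?A\<^esub> group_algebra_basis K G g \<oplus>\<^bsub>?A\<^esub> tr S"
      using insert(2,4) fc by (auto simp: tr_def group_algebra_simps group_algebra_basis_def intro!: restrict_ext)
    then have "h (tr (insert g S)) = f g \<odot>\<^bsub>?B\<^esub> h (group_algebra_basis K G g) \<oplus>\<^bsub>?B\<^esub> h (tr S)"
      using add[of "f g \<odot>\<^bsub>?A\<^esub> group_algebra_basis K G g" "tr S"] smult[OF _ bas, of "f g" g]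
        insert(4) fc[of g] bas[of g] tr[of S]
      by (simp add: cA group_algebra_simps(5) PiE_iff)
    then have "h (tr (insert g S)) k = f g \<otimes>\<^bsub>K\<^esub> h (group_algebra_basis K G g) k \<oplus>\<^bsub>K\<^esub> h (tr S) k"
      using k by (simp add: group_algebra_simps)
    also have "\<dots> = (\<Oplus>\<^bsub>K\<^esub>g\<in>insert g S. f g \<otimes>\<^bsub>K\<^esub> h (group_algebra_basis K G g) k)"
      using insert fc hk[OF bas] by (subst K.finsum_insert) (auto simp: subset_iff)
    finally show ?case .
  qed
  moreover have "tr (carrier G) = f"
    using f by (auto simp: tr_def cA PiE_iff extensional_def)
  ultimately show ?thesis
    using assms(2) by force
qed

text \<open>Row \<open>g\<close> of \<open>M\<close> is the image of the basis element
  \<open>g\<close>, and \<open>N\<close> is built likewise from the inverse map. Expanding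
  \<open>h' (M g)\<close> and \<open>h (N k)\<close> in coordinates yields the two inverse
  identities, and products of basis elements yield the convolution identity.\<close>

lemma algebra_iso_exists_matrix:
  assumes "cring K" "group G" "finite (carrier G)" "group H" "finite (carrier H)"
    and "algebra_isomorphic K (group_algebra K G) (group_algebra K H)"
  shows "\<exists>M N. group_algebra_iso_matrix K G H M N"
proof -
  interpret K: cring K by fact
  interpret G: group G by fact
  interpret H: group H by fact
  let ?A = "group_algebra K G" and ?B = "group_algebra K H"
  note cA = group_algebra_simps(2)[OF assms(3), of K] and cB = group_algebra_simps(2)[OF assms(5), of K]
  obtain h where "h \<in> algebra_iso K ?A ?B"
    using assms(6) by (auto simp: algebra_isomorphic_def)
  then have hom: "h \<in> ring_hom ?A ?B" and bij: "bij_betw h (carrier ?A) (carrier ?B)"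
    and smult: "\<And>a u. a \<in> carrier K \<Longrightarrow> u \<in> carrier ?A \<Longrightarrow> h (a \<odot>\<^bsub>?A\<^esub> u) = a \<odot>\<^bsub>?B\<^esub> h u"
    by (auto simp: algebra_iso_def ring_iso_def)
  define h' where "h' = inv_into (carrier ?A) h"
  have inv: "\<And>u. u \<in> carrier ?A \<Longrightarrow> h' (h u) = u" "\<And>v. v \<in> carrier ?B \<Longrightarrow> h (h' v) = v"
    "\<And>v. v \<in> carrier ?B \<Longrightarrow> h' v \<in> carrier ?A"
    using bij by (auto simp: h'_def bij_betw_def inv_into_f_f f_inv_into_f inv_into_into)
  have h_closed: "\<And>u. u \<in> carrier ?A \<Longrightarrow> h u \<in> carrier ?B"
    using ring_hom_closed[OF hom] .
  have add': "h' (u \<oplus>\<^bsub>?B\<^esub> v) = h' u \<oplus>\<^bsub>?A\<^esub> h' v" if uv: "u \<in> carrier ?B" "v \<in> carrier ?B" for u v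
  proof -
    have "h' u \<oplus>\<^bsub>?A\<^esub> h' v \<in> carrier ?A"
      using inv(3)[OF uv(1)] inv(3)[OF uv(2)] by (auto simp: cA group_algebra_simps(4) PiE_iff)
    then show ?thesis
      using inv(1)[of "h' u \<oplus>\<^bsub>?A\<^esub> h' v"] ring_hom_add[OF hom inv(3)[OF uv(1)] inv(3)[OF uv(2)]] inv(2) uv by simp
  qed
  have smult': "h' (a \<odot>\<^bsub>?B\<^esub> u) = a \<odot>\<^bsub>?A\<^esub> h' u" if au: "a \<in> carrier K" "u \<in> carrier ?B" for a u
  proof -
    have "a \<odot>\<^bsub>?A\<^esub> h' u \<in> carrier ?A"
      using inv(3)[OF au(2)] au(1) by (auto simp: cA group_algebra_simps(5) PiE_iff)
    then show ?thesis
      using inv(1)[of "a \<odot>\<^bsub>?A\<^esub> h' u"] smult[OF au(1) inv(3)[OF au(2)]] inv(2) au by simp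
  qed
  have bas: "group_algebra_basis K G g \<in> carrier ?A" "group_algebra_basis K H k \<in> carrier ?B" for g k
    by (simp_all add: group_algebra_basis_closed[OF K.ring_axioms] assms(3,5))
  define M where "M g = h (group_algebra_basis K G g)" for g
  define N where "N k = h' (group_algebra_basis K H k)" for k
  have MN: "M g \<in> carrier ?B" "N k \<in> carrier ?A" for g k
    using bas h_closed inv(3) by (auto simp: M_def N_def)
  have expand: "h u k = (\<Oplus>\<^bsub>K\<^esub>g\<in>carrier G. u g \<otimes>\<^bsub>K\<^esub> M g k)"
    if "u \<in> carrier ?A" "k \<in> carrier H" for u k
    unfolding M_def using that assms h_closed ring_hom_add[OF hom] smult
    by (intro group_algebra_linear_expand)
  have expand': "h' v g = (\<Oplus>\<^bsub>K\<^esub>k\<in>carrier H. v k \<otimes>\<^bsub>K\<^esub> N k g)"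
    if "v \<in> carrier ?B" "g \<in> carrier G" for v g
    unfolding N_def using that assms inv(3) add' smult'
    by (intro group_algebra_linear_expand)
  have mult: "M (g \<otimes>\<^bsub>G\<^esub> g') k = (\<Oplus>\<^bsub>K\<^esub>w\<in>carrier H. M g w \<otimes>\<^bsub>K\<^esub> M g' (inv\<^bsub>H\<^esub> w \<otimes>\<^bsub>H\<^esub> k))"
    if "g \<in> carrier G" "g' \<in> carrier G" "k \<in> carrier H" for g g' k
  proof -
    have "M (g \<otimes>\<^bsub>G\<^esub> g') = M g \<otimes>\<^bsub>?B\<^esub> M g'"
      unfolding M_def using that bas
      by (simp add: group_algebra_basis_mult[OF assms(1-3), symmetric] ring_hom_mult[OF hom])
    then show ?thesis
      using group_algebra_mult[OF assms(1,4,5) MN(1)[of g] MN(1)[of g']] that(3) by simp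
  qed
  have one: "M \<one>\<^bsub>G\<^esub> k = (if k = \<one>\<^bsub>H\<^esub> then \<one>\<^bsub>K\<^esub> else \<zero>\<^bsub>K\<^esub>)" if "k \<in> carrier H" for k
  proof -
    have "M \<one>\<^bsub>G\<^esub> = \<one>\<^bsub>?B\<^esub>"
      unfolding M_def using ring_hom_one[OF hom]
      by (simp add: group_algebra_basis_def group_algebra_simps(3)[of K G])
    then show ?thesis using that by (simp add: group_algebra_simps(3))
  qed
  have MN1: "(\<Oplus>\<^bsub>K\<^esub>k\<in>carrier H. M g k \<otimes>\<^bsub>K\<^esub> N k g') = (if g = g' then \<one>\<^bsub>K\<^esub> else \<zero>\<^bsub>K\<^esub>)"
    if "g \<in> carrier G" "g' \<in> carrier G" for g g'
  proof -
    have "(\<Oplus>\<^bsub>K\<^esub>k\<in>carrier H. M g k \<otimes>\<^bsub>K\<^esub> N k g') = h' (M g) g'"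
      by (rule expand'[OF MN(1) that(2), symmetric])
    also have "h' (M g) = group_algebra_basis K G g"
      unfolding M_def by (rule inv(1)[OF bas(1)])
    finally show ?thesis
      using that by (auto simp: group_algebra_basis_def)
  qed
  have MN2: "(\<Oplus>\<^bsub>K\<^esub>g\<in>carrier G. N k g \<otimes>\<^bsub>K\<^esub> M g k') = (if k = k' then \<one>\<^bsub>K\<^esub> else \<zero>\<^bsub>K\<^esub>)"
    if "k \<in> carrier H" "k' \<in> carrier H" for k k'
  proof -
    have "(\<Oplus>\<^bsub>K\<^esub>g\<in>carrier G. N k g \<otimes>\<^bsub>K\<^esub> M g k') = h (N k) k'"
      by (rule expand[OF MN(2) that(2), symmetric])
    also have "h (N k) = group_algebra_basis K H k"
      unfolding N_def by (rule inv(2)[OF bas(2)])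
    finally show ?thesis
      using that by (auto simp: group_algebra_basis_def)
  qed
  have closed: "M g k \<in> carrier K" "N k g \<in> carrier K" if "g \<in> carrier G" "k \<in> carrier H" for g k
    using MN(1)[of g] MN(2)[of k] that by (auto simp: cA cB PiE_iff)
  have "group_algebra_iso_matrix K G H M N"
    unfolding group_algebra_iso_matrix_def
    by (intro conjI ballI closed mult one MN1 MN2)
  then show ?thesis by blast
qed

section \<open>Countability and descent\<close>

text \<open>Formal names for the elements generated by one: the constructors mirror the closure
  rules of \<open>generate_field\<close> over the empty set, and there are only countably many
  terms.\<close>

datatype field_term = One | Neg field_term | Inverse field_term
  | Add field_term field_term | Mult field_term field_term

instance field_term :: countable
  by countable_datatype

primrec field_term_val :: "('a, 'm) ring_scheme \<Rightarrow> field_term \<Rightarrow> 'a" where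
  "field_term_val R One = \<one>\<^bsub>R\<^esub>"
| "field_term_val R (Neg s) = \<ominus>\<^bsub>R\<^esub> field_term_val R s"
| "field_term_val R (Inverse s) = inv\<^bsub>R\<^esub> field_term_val R s"
| "field_term_val R (Add s t) = field_term_val R s \<oplus>\<^bsub>R\<^esub> field_term_val R t"
| "field_term_val R (Mult s t) = field_term_val R s \<otimes>\<^bsub>R\<^esub> field_term_val R t"

text \<open>It suffices that every element has a name. Terms such as the inverse of a zero value may
  denote anything, since only the inclusion into the range is used.\<close>

lemma (in field) countable_prime_field: "countable (prime_field R)"
proof -
  have "x \<in> range (field_term_val R)" if "x \<in> generate_field R {}" for x
    using that
  proof induct
    case one
    show ?case by (rule range_eqI[of _ _ One]) simp
  next
    case (a_inv h)
    then obtain s where "h = field_term_val R s" by blast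
    then show ?case by (intro range_eqI[of _ _ "Neg s"]) simp
  next
    case (m_inv h)
    then obtain s where "h = field_term_val R s" by blast
    then show ?case by (intro range_eqI[of _ _ "Inverse s"]) simp
  next
    case (eng_add h1 h2)
    then obtain s t where "h1 = field_term_val R s" "h2 = field_term_val R t" by blast
    then show ?case by (intro range_eqI[of _ _ "Add s t"]) simp
  next
    case (eng_mult h1 h2)
    then obtain s t where "h1 = field_term_val R s" "h2 = field_term_val R t" by blast
    then show ?case by (intro range_eqI[of _ _ "Mult s t"]) simp
  qed simp
  moreover have "prime_field R = generate_field R {}"
    using generate_field_min_subfield2[of "{}"] by (simp add: prime_field_def)
  ultimately show ?thesis
    by (metis countableI_type countable_image countable_subset subsetI)
qed

text \<open>Each adjunction is the image, under evaluation, of polynomials that are finite lists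
  over a countable set.\<close>

lemma (in ring) countable_finite_extension:
  assumes "countable K" "K \<subseteq> carrier R" "set xs \<subseteq> carrier R"
  shows "countable (finite_extension K xs)"
  using assms(3)
proof (induct xs)
  case Nil
  then show ?case using assms(1) by simp
next
  case (Cons x xs)
  let ?K = "finite_extension K xs"
  have "carrier (?K [X]) \<subseteq> lists ?K"
    by (auto simp: univ_poly_carrier[symmetric] polynomial_def)
  then have "countable (carrier (?K [X]))"
    using Cons countable_lists countable_subset by (metis insert_subset list.simps(15))
  then show ?case
    using finite_extension_as_eval_img[OF assms(2)] Cons(2) by simp
qed

section \<open>Descent to a finite extension of the prime field\<close>

theorem theorem1:
  fixes F :: "('f, 'm) ring_scheme"
    and G :: "('g, 'n) monoid_scheme"
    and H :: "('h, 'l) monoid_scheme"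
  assumes "field F"
    and "group G" and "finite (carrier G)"
    and "group H" and "finite (carrier H)"
    and "algebra_isomorphic F (group_algebra F G) (group_algebra F H)"
  shows "\<exists>(F\<^sub>0 :: nat ring) \<phi>.
    finite_field_extension (F\<lparr>carrier := prime_field F\<rparr>) F\<^sub>0 \<phi> \<and>
    algebra_isomorphic F\<^sub>0 (group_algebra F\<^sub>0 G) (group_algebra F\<^sub>0 H)"
proof -
  interpret F: field F by fact
  define P where "P = F\<lparr>carrier := prime_field F\<rparr>"
  have P_simps: "carrier P = prime_field F" "\<zero>\<^bsub>P\<^esub> = \<zero>\<^bsub>F\<^esub>"
    by (simp_all add: P_def)
  have subfield_P: "subfield (prime_field F) F"
    by (rule F.prime_field_is_subfield)
  interpret P: field P
    unfolding P_def using F.subfield_iff(2)[OF subfield_P] .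
  obtain M N where MN: "group_algebra_iso_matrix F G H M N"
    using algebra_iso_exists_matrix[OF F.cring_axioms assms(2-6)] by blast
  define S where "S = (\<lambda>(g, k). M g k) ` (carrier G \<times> carrier H) \<union> (\<lambda>(g, k). N k g) ` (carrier G \<times> carrier H)"
  have "finite S" using assms(3,5) by (simp add: S_def)
  then obtain xs where xs: "set xs = S" using finite_list by blast
  have xs_F: "set xs \<subseteq> carrier F"
    using MN by (auto simp: xs S_def group_algebra_iso_matrix_def)
  define K where "K = F.finite_extension (prime_field F) xs"
  have K: "subring K F"
    unfolding K_def using F.finite_extension_is_subring[OF subfieldE(1)[OF subfield_P] xs_F] .
  have S_K: "S \<subseteq> K"
    unfolding K_def using F.finite_extension_mem[OF subfieldE(1)[OF subfield_P] xs_F] xs by simp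
  have P_K: "prime_field F \<subseteq> K"
    unfolding K_def using F.finite_extension_incl[OF subfieldE(3)[OF subfield_P] xs_F] .
  define \<iota> :: "'f \<Rightarrow> ('f list \<times> nat) multiset \<Rightarrow> 'f" where "\<iota> = P.indexed_const"
  \<comment> \<open>The closure is taken of \<open>P\<close> and not of \<open>F\<close>: every
    element of \<open>L\<close> is then algebraic over the image of \<open>P\<close>, so finitely
    many of them generate a finite extension.\<close>
  define L where "L = P.alg_closure"
  interpret L: algebraic_closure L "\<iota> ` carrier P"
    unfolding L_def \<iota>_def by (rule P.alg_closureE)
  have \<iota>: "\<iota> \<in> ring_hom P L"
    unfolding L_def \<iota>_def by (rule P.alg_closureE)
  interpret \<iota>: ring_hom_ring P L \<iota>
    using \<iota> by (rule ring_hom_ringI2[OF P.ring_axioms L.ring_axioms])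
  have \<iota>_zero: "c = \<zero>\<^bsub>F\<^esub>" if "c \<in> prime_field F" "\<iota> c = \<zero>\<^bsub>L\<^esub>" for c
  proof -
    have "inj_on \<iota> (carrier P)"
      using \<iota>.img_is_subfield(1)[OF P.carrier_is_subfield] by simp
    moreover have "\<iota> c = \<iota> \<zero>\<^bsub>P\<^esub>"
      using that(2) \<iota>.hom_zero by simp
    ultimately have "c = \<zero>\<^bsub>P\<^esub>"
      using that(1) P.zero_closed unfolding P_simps(1) by (rule inj_onD)
    then show ?thesis by (simp only: P_simps)
  qed
  obtain \<psi> where \<psi>: "\<psi> \<in> ring_hom (F\<lparr>carrier := K\<rparr>) L" "\<And>x. x \<in> prime_field F \<Longrightarrow> \<psi> x = \<iota> x"
  proof -
    \<comment> \<open>The nonzero element carried by the induction is started at one.\<close>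
    have "\<one>\<^bsub>F\<^esub> \<in> K" by (rule subringE(3)[OF K])
    from ring_hom_extend_finite_extension[OF F.field_axioms subfieldE(1)[OF subfield_P] xs_F
        L.algebraically_closed_axioms \<iota>[unfolded P_def] \<iota>_zero this[unfolded K_def] F.one_not_zero]
    show ?thesis
      using that unfolding K_def by blast
  qed
  interpret FK: ring "F\<lparr>carrier := K\<rparr>" using F.subring_is_ring[OF K] .
  interpret \<psi>: ring_hom_ring "F\<lparr>carrier := K\<rparr>" L \<psi>
    using \<psi>(1) by (rule ring_hom_ringI2[OF FK.ring_axioms L.ring_axioms])
  let ?P = "\<iota> ` carrier P"
  define E where "E = L.finite_extension ?P (map \<psi> xs)"
  have \<psi>xs: "set (map \<psi> xs) \<subseteq> carrier L"
    using S_K xs \<psi>.hom_closed by auto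
  have E: "subfield E L" and fin: "L.finite_dimension ?P E"
    unfolding E_def
    using L.finite_extension_is_subfield[OF L.subfield_axioms \<psi>xs]
      L.finite_extension_finite_dimension(1)[OF L.subfield_axioms \<psi>xs]
      L.algebraic_extension \<psi>xs by blast+
  have P_E: "?P \<subseteq> E"
    unfolding E_def using L.finite_extension_incl[OF subfieldE(3)[OF L.subfield_axioms] \<psi>xs] .
  have xs_E: "set (map \<psi> xs) \<subseteq> E"
    unfolding E_def using L.finite_extension_mem[OF subfieldE(1)[OF L.subfield_axioms] \<psi>xs] .
  have \<psi>_E: "\<psi> x \<in> E" if "x \<in> K" for x
  proof -
    note E' = subfieldE(1)[OF E]
    \<comment> \<open>Elements of \<open>K\<close> sent into \<open>E\<close> form a subring of
      \<open>F\<close> that contains the prime field and the generators \<open>xs\<close>, hence all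
      of \<open>K\<close>.\<close>
    have "subring {x \<in> K. \<psi> x \<in> E} F"
    proof (rule F.subringI)
      show "{x \<in> K. \<psi> x \<in> E} \<subseteq> carrier F" using subringE(1)[OF K] by auto
      show "\<one>\<^bsub>F\<^esub> \<in> {x \<in> K. \<psi> x \<in> E}"
        using subringE(3)[OF K] subringE(3)[OF E'] \<psi>.hom_one by simp
    next
      fix h assume h: "h \<in> {x \<in> K. \<psi> x \<in> E}"
      \<comment> \<open>Negation is defined relative to the carrier; uniqueness of additive inverses
        identifies the one in the subring with the one in \<open>F\<close>.\<close>
      have "\<ominus>\<^bsub>F\<^esub> h = \<ominus>\<^bsub>F\<lparr>carrier := K\<rparr>\<^esub> h"
        using h FK.minus_equality[of "\<ominus>\<^bsub>F\<^esub> h" h] subringE(5)[OF K, of h] subringE(1)[OF K]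
        by (auto simp: F.l_neg subset_iff)
      then have "\<psi> (\<ominus>\<^bsub>F\<^esub> h) = \<ominus>\<^bsub>L\<^esub> \<psi> h" using h by simp
      then show "\<ominus>\<^bsub>F\<^esub> h \<in> {x \<in> K. \<psi> x \<in> E}"
        using h subringE(5)[OF K] subringE(5)[OF E'] by simp
    next
      fix h1 h2 assume h: "h1 \<in> {x \<in> K. \<psi> x \<in> E}" "h2 \<in> {x \<in> K. \<psi> x \<in> E}"
      then show "h1 \<otimes>\<^bsub>F\<^esub> h2 \<in> {x \<in> K. \<psi> x \<in> E}" "h1 \<oplus>\<^bsub>F\<^esub> h2 \<in> {x \<in> K. \<psi> x \<in> E}"
        using \<psi>.hom_mult[of h1 h2] \<psi>.hom_add[of h1 h2] subringE(6,7)[OF K] subringE(6,7)[OF E'] by auto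
    qed
    moreover have "prime_field F \<subseteq> {x \<in> K. \<psi> x \<in> E}"
      using P_K P_E \<psi>(2) unfolding P_simps(1) by auto
    moreover have "set xs \<subseteq> {x \<in> K. \<psi> x \<in> E}"
      using S_K xs xs_E by auto
    ultimately show ?thesis
      using F.finite_extension_subring_incl[of "{x \<in> K. \<psi> x \<in> E}" "prime_field F" xs] that
      unfolding K_def by blast
  qed
  have "countable ?P"
    using F.countable_prime_field unfolding P_simps(1) by (rule countable_image)
  then have "countable E"
    unfolding E_def using L.countable_finite_extension \<psi>xs subfieldE(3)[OF L.subfield_axioms] by blast
  \<comment> \<open>The enumeration is injective whether \<open>E\<close> is finite or infinite; the
    field structure is then carried over along it.\<close>
  define j where "j = to_nat_on E"
  have j: "inj_on j E"
    unfolding j_def using \<open>countable E\<close> by (rule inj_on_to_nat_on)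
  define LE where "LE = L\<lparr>carrier := E\<rparr>"
  interpret LE: field LE
    unfolding LE_def using L.subfield_iff(2)[OF E] .
  define F\<^sub>0 where "F\<^sub>0 = image_ring j LE"
  interpret F\<^sub>0: field F\<^sub>0
    unfolding F\<^sub>0_def using LE.inj_imp_image_ring_is_field[of j] j by (simp add: LE_def)
  have j_hom: "j \<in> ring_hom LE F\<^sub>0" and carrier_F\<^sub>0: "carrier F\<^sub>0 = j ` E"
    using inj_imp_image_ring_iso[of j LE] j
    by (auto simp: ring_iso_def F\<^sub>0_def LE_def image_ring_carrier)
  interpret j: ring_hom_ring LE F\<^sub>0 j
    using j_hom by (rule ring_hom_ringI2[OF LE.ring_axioms F\<^sub>0.ring_axioms])
  have "\<psi> \<in> ring_hom (F\<lparr>carrier := K\<rparr>) LE"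
    using \<psi>(1) \<psi>_E by (auto simp: ring_hom_def LE_def)
  then have \<theta>: "j \<circ> \<psi> \<in> ring_hom (F\<lparr>carrier := K\<rparr>) F\<^sub>0"
    using j_hom by (rule ring_hom_trans)
  have "\<iota> \<in> ring_hom P LE"
    using \<iota> P_E by (auto simp: ring_hom_def LE_def)
  then have \<phi>: "j \<circ> \<iota> \<in> ring_hom P F\<^sub>0"
    using j_hom by (rule ring_hom_trans)
  have sub_P: "subfield ?P LE"
    unfolding LE_def using L.subfield_iff L.subfield_axioms E P_E L.subring_is_ring[OF subfieldE(1)[OF E]]
    by (intro ring.subfield_iff(1)) auto
  \<comment> \<open>Finite dimension is transported through a spanning list: \<open>j\<close> maps
    the span of \<open>Us\<close> onto the span of the images over the image field.\<close>
  obtain Us where Us: "set Us \<subseteq> carrier L" "E = L.Span ?P Us"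
    using fin L.exists_base[OF L.subfield_axioms] unfolding L.finite_dimension_def by metis
  have Us_E: "set Us \<subseteq> E"
    using L.Span_base_incl[OF L.subfield_axioms Us(1)] Us(2) by simp
  have "j ` E = F\<^sub>0.Span (j ` ?P) (map j Us)"
    using j.Span_hom[of ?P Us] P_E Us_E Us(2) L.Span_consistent[OF subfieldE(1)[OF E]]
    by (simp add: LE_def)
  moreover have "subfield (j ` ?P) F\<^sub>0"
    using j.img_is_subfield(2)[OF sub_P] by simp
  moreover have "set (map j Us) \<subseteq> carrier F\<^sub>0"
    using Us_E by (auto simp: carrier_F\<^sub>0)
  ultimately have "F\<^sub>0.finite_dimension (j ` ?P) (carrier F\<^sub>0)"
    using F\<^sub>0.Span_finite_dimension by (simp add: carrier_F\<^sub>0)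
  then have ext: "finite_field_extension P F\<^sub>0 (j \<circ> \<iota>)"
    unfolding finite_field_extension_def
    using P.field_axioms F\<^sub>0.field_axioms \<phi> by (simp add: image_comp)
  \<comment> \<open>The entries already satisfy the matrix conditions over \<open>K\<close>, so
    \<open>j \<circ> \<psi>\<close> carries the pair to the new field.\<close>
  have "group_algebra_iso_matrix (F\<lparr>carrier := K\<rparr>) G H M N"
    using S_K by (intro group_algebra_iso_matrix_subring[OF F.cring_axioms K assms(2,4) MN]) (auto simp: S_def)
  moreover have "ring_hom_cring (F\<lparr>carrier := K\<rparr>) F\<^sub>0 (j \<circ> \<psi>)"
    using \<theta> F\<^sub>0.cring_axioms domain.axioms(1)[OF F.subring_is_domain[OF K]] by (intro ring_hom_cringI)
  ultimately have "algebra_isomorphic F\<^sub>0 (group_algebra F\<^sub>0 G) (group_algebra F\<^sub>0 H)"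
    using algebra_isomorphic_of_matrix[OF F\<^sub>0.cring_axioms assms(2-5)]
      group_algebra_iso_matrix_map[OF _ assms(2,4)] by blast
  then show ?thesis
    using ext unfolding P_def by blast
qed

end
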